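(* Let $(X_1,d_1)$, $(X_2,d_2)$ be proper $\mathrm{CAT}(-1)$ spaces and let $\overline{X_1\times X_2}^{\max}$ be the horofunction compactification of $X_1\times X_2$ with respect to $d_{\max}$. Let $\Gamma$ be a hyperbolic group and let $\rho_1\colon\Gamma\to\operatorname{Isom}(X_1)$, $\rho_2\colon\Gamma\to\operatorname{Isom}(X_2)$ be two cocompact discrete representations with finite kernel. If $\rho_1$ and $\rho_2$ are coarsely equivalent, then there exists an open subset $\Omega^{\max}_\Gamma\subset\partial_\infty^{\max}(X_1\times X_2)$ such that the product action of $\Gamma$ on $(X_1\times X_2)\cup\Omega^{\max}_\Gamma$ is properly discontinuous and cocompact.
   Context: Horofunction compactification: for a proper metric space $(Y,d)$ let $C_*(Y)$ be the space of continuous real functions on $Y$ (topology of uniform convergence on compact sets) modulo additive constants, and $\iota\colon Y\to C_*(Y)$, $\iota(y)=[d(y,\cdot)]$. The horofunction compactification is the closure of $\iota(Y)$ in $C_*(Y)$; the ideal boundary is the complement of $\iota(Y)$ in it; $Y$ is identified with $\iota(Y)$. Isometries of $Y$ act on the compactification by homeomorphisms. $d_{\max}((x,y),(x',y'))=\max\{d_1(x,x'),d_2(y,y')\}$, and $\partial_\infty^{\max}(X_1\times X_2)$ denotes the ideal boundary of $\overline{X_1\times X_2}^{\max}$. The product action is $\gamma(x,y)=(\rho_1(\gamma)x,\rho_2(\gamma)y)$, extended to $\overline{X_1\times X_2}^{\max}$; $(X_1\times X_2)\cup\Omega^{\max}_\Gamma$ has the subspace topology. A representation $\rho_i$ is discrete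 if $\rho_i(\Gamma)$ is a discrete subgroup of $\operatorname{Isom}(X_i)$, and cocompact if the action on $X_i$ is cocompact. An action of $\Gamma$ on $Z$ is properly discontinuous if for every compact $K\subset Z$ the set $\{\gamma\in\Gamma:\gamma K\cap K\ne\emptyset\}$ is finite; cocompact if there is a compact $K\subset Z$ whose translates cover $Z$. $\rho_1,\rho_2$ are coarsely equivalent if there exist $C>0$, $o\in X_1$, $o'\in X_2$ such that $|d_1(\rho_1(\gamma)o,\rho_1(\gamma')o)-d_2(\rho_2(\gamma)o',\rho_2(\gamma')o')|\le C$ for all $\gamma,\gamma'\in\Gamma$. *)

theory Defs
  imports "HOL-Analysis.Analysis" "HOL-Algebra.Generated_Groups"
begin

text \<open>Metric spaces are types of class \<open>metric_space\<close>; a proper metric space is a type of class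
  \<open>heine_borel\<close>.\<close>

section \<open>CAT(-1) spaces\<close>

text \<open>The hyperbolic plane of curvature -1, in the upper half-plane model.\<close>

definition hyperbolic_plane :: "complex set" where
  "hyperbolic_plane = {z. Im z > 0}"

definition hyp_dist :: "complex \<Rightarrow> complex \<Rightarrow> real" where
  "hyp_dist z w = arcosh (1 + (cmod (z - w))\<^sup>2 / (2 * Im z * Im w))"

definition geodesic_path :: "(real \<Rightarrow> 'a::metric_space) \<Rightarrow> 'a \<Rightarrow> 'a \<Rightarrow> bool" where
  "geodesic_path c x y \<longleftrightarrow>
     c 0 = x \<and> c (dist x y) = y \<and>
     (\<forall>s\<in>{0..dist x y}. \<forall>t\<in>{0..dist x y}. dist (c s) (c t) = \<bar>s - t\<bar>)"

definition comparison_triangle ::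
    "'a::metric_space \<Rightarrow> 'a \<Rightarrow> 'a \<Rightarrow> complex \<Rightarrow> complex \<Rightarrow> complex \<Rightarrow> bool" where
  "comparison_triangle x y z x' y' z' \<longleftrightarrow>
     x' \<in> hyperbolic_plane \<and> y' \<in> hyperbolic_plane \<and> z' \<in> hyperbolic_plane \<and>
     hyp_dist x' y' = dist x y \<and> hyp_dist y' z' = dist y z \<and> hyp_dist z' x' = dist z x"

text \<open>The two distance equations say that \<open>p'\<close> lies on the hyperbolic segment from \<open>x'\<close> to
  \<open>y'\<close>, in the same position as \<open>p\<close> on a geodesic segment from \<open>x\<close> to \<open>y\<close>.\<close>

definition comparison_point ::
    "'a::metric_space \<Rightarrow> 'a \<Rightarrow> 'a \<Rightarrow> complex \<Rightarrow> complex \<Rightarrow> complex \<Rightarrow> bool" where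
  "comparison_point x y p x' y' p' \<longleftrightarrow>
     p' \<in> hyperbolic_plane \<and> hyp_dist x' p' = dist x p \<and> hyp_dist p' y' = dist p y"

text \<open>The CAT(-1) inequality is stated for \<open>p\<close> on the side \<open>[x,y]\<close> and \<open>q\<close> on the side \<open>[x,z]\<close>.
  The vertices are arbitrary, so this covers any two different sides of any geodesic triangle;
  for two points of one side the inequality is an equality.\<close>

definition CAT_minus1 :: "'a::metric_space itself \<Rightarrow> bool" where
  "CAT_minus1 (_ :: 'a itself) \<longleftrightarrow>
     (\<forall>x y :: 'a. \<exists>c. geodesic_path c x y) \<and>
     (\<forall>(x::'a) y z c\<^sub>1 c\<^sub>2 c\<^sub>3 p q x' y' z' p' q'.
        geodesic_path c\<^sub>1 x y \<longrightarrow> geodesic_path c\<^sub>2 x z \<longrightarrow> geodesic_path c\<^sub>3 y z \<longrightarrow>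
        p \<in> c\<^sub>1 ` {0..dist x y} \<longrightarrow> q \<in> c\<^sub>2 ` {0..dist x z} \<longrightarrow>
        comparison_triangle x y z x' y' z' \<longrightarrow>
        comparison_point x y p x' y' p' \<longrightarrow> comparison_point x z q x' z' q' \<longrightarrow>
        dist p q \<le> hyp_dist p' q')"


section \<open>Uniform convergence on compact sets\<close>

definition ucc_nhd ::
    "('a::topological_space \<Rightarrow> 'b::metric_space) \<Rightarrow> 'a set \<Rightarrow> real \<Rightarrow> ('a \<Rightarrow> 'b) set" where
  "ucc_nhd f K \<epsilon> = {g. continuous_on UNIV g \<and> (\<forall>x\<in>K. dist (f x) (g x) < \<epsilon>)}"

definition ucc_topology :: "('a::topological_space \<Rightarrow> 'b::metric_space) topology" where
  "ucc_topology = topology (\<lambda>U. U \<subseteq> {f. continuous_on UNIV f} \<and>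
     (\<forall>f\<in>U. \<exists>K \<epsilon>. compact K \<and> \<epsilon> > 0 \<and> ucc_nhd f K \<epsilon> \<subseteq> U))"

lemma openin_ucc_topology:
  "openin ucc_topology U \<longleftrightarrow> U \<subseteq> {f. continuous_on UNIV f} \<and>
     (\<forall>f\<in>U. \<exists>K \<epsilon>. compact K \<and> \<epsilon> > 0 \<and> ucc_nhd f K \<epsilon> \<subseteq> U)"
proof -
  let ?P = "\<lambda>U :: ('a \<Rightarrow> 'b) set. U \<subseteq> {f. continuous_on UNIV f} \<and>
     (\<forall>f\<in>U. \<exists>K \<epsilon>. compact K \<and> \<epsilon> > 0 \<and> ucc_nhd f K \<epsilon> \<subseteq> U)"
  have "istopology ?P"
    unfolding istopology_def
  proof (intro conjI allI impI)
    fix S T :: "('a \<Rightarrow> 'b) set" assume S: "?P S" and T: "?P T"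
    show "S \<inter> T \<subseteq> {f. continuous_on UNIV f}" using S by blast
    show "\<forall>f\<in>S \<inter> T. \<exists>K \<epsilon>. compact K \<and> \<epsilon> > 0 \<and> ucc_nhd f K \<epsilon> \<subseteq> S \<inter> T"
    proof
      fix f assume "f \<in> S \<inter> T"
      then obtain K \<epsilon> L \<delta> where K: "compact K" "\<epsilon> > 0" "ucc_nhd f K \<epsilon> \<subseteq> S"
        and L: "compact L" "\<delta> > 0" "ucc_nhd f L \<delta> \<subseteq> T"
        using S T by (metis IntD1 IntD2)
      have "ucc_nhd f (K \<union> L) (min \<epsilon> \<delta>) \<subseteq> ucc_nhd f K \<epsilon> \<inter> ucc_nhd f L \<delta>"
        unfolding ucc_nhd_def by auto
      then have "compact (K \<union> L) \<and> min \<epsilon> \<delta> > 0 \<and> ucc_nhd f (K \<union> L) (min \<epsilon> \<delta>) \<subseteq> S \<inter> T"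
        using K L compact_Un by auto
      then show "\<exists>K \<epsilon>. compact K \<and> \<epsilon> > 0 \<and> ucc_nhd f K \<epsilon> \<subseteq> S \<inter> T" by blast
    qed
  next
    fix \<K> :: "('a \<Rightarrow> 'b) set set" assume *: "\<forall>U\<in>\<K>. ?P U"
    then show "\<Union>\<K> \<subseteq> {f. continuous_on UNIV f}" by blast
    show "\<forall>f\<in>\<Union>\<K>. \<exists>K \<epsilon>. compact K \<and> \<epsilon> > 0 \<and> ucc_nhd f K \<epsilon> \<subseteq> \<Union>\<K>"
      using * by (meson UnionE Union_upper subset_trans)
  qed
  then show ?thesis
    unfolding ucc_topology_def by (simp add: topology_inverse')
qed

lemma topspace_ucc_topology: "topspace ucc_topology = {f. continuous_on UNIV f}"
proof -
  have "openin ucc_topology {f :: 'a::topological_space \<Rightarrow> 'b::metric_space. continuous_on UNIV f}"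
    unfolding openin_ucc_topology ucc_nhd_def by (auto intro!: exI[of _ "{}"] exI[of _ 1])
  then show ?thesis
    using iffD1[OF openin_ucc_topology openin_topspace] openin_subset by blast
qed


section \<open>The horofunction compactification\<close>

definition add_const_rel :: "(('y::topological_space \<Rightarrow> real) \<times> ('y \<Rightarrow> real)) set" where
  "add_const_rel = {(f, g). continuous_on UNIV f \<and> continuous_on UNIV g \<and>
     (\<exists>c. \<forall>x. g x = f x + c)}"

definition mod_const :: "('y::topological_space \<Rightarrow> real) \<Rightarrow> ('y \<Rightarrow> real) set" where
  "mod_const f = add_const_rel `` {f}"

lemma equiv_add_const_rel: "equiv {f. continuous_on UNIV f} add_const_rel"
proof (rule equivI)
  show "add_const_rel \<subseteq> {f. continuous_on UNIV f} \<times> {f. continuous_on UNIV f}"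
    by (auto simp: add_const_rel_def)
  show "refl_on {f. continuous_on UNIV f} add_const_rel"
    by (auto simp: refl_on_def add_const_rel_def intro: exI[of _ 0])
  show "sym add_const_rel"
    unfolding sym_def add_const_rel_def by (force intro: exI[of _ "- c" for c])
  show "trans add_const_rel"
    unfolding trans_def add_const_rel_def by (force simp: add.assoc)
qed

text \<open>The quotient space of continuous real functions modulo additive constants.\<close>

definition C_star :: "('y::topological_space \<Rightarrow> real) set topology" where
  "C_star = topology (\<lambda>V. V \<subseteq> {f. continuous_on UNIV f} // add_const_rel \<and>
     openin ucc_topology {f. continuous_on UNIV f \<and> mod_const f \<in> V})"

lemma openin_C_star:
  "openin C_star V \<longleftrightarrow> V \<subseteq> {f. continuous_on UNIV f} // add_const_rel \<and>
     openin ucc_topology {f. continuous_on UNIV f \<and> mod_const f \<in> V}"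
proof -
  let ?P = "\<lambda>V :: ('a \<Rightarrow> real) set set. V \<subseteq> {f. continuous_on UNIV f} // add_const_rel \<and>
     openin ucc_topology {f. continuous_on UNIV f \<and> mod_const f \<in> V}"
  have "istopology ?P"
    unfolding istopology_def
  proof (intro conjI allI impI)
    fix S T assume S: "?P S" and T: "?P T"
    show "S \<inter> T \<subseteq> {f. continuous_on UNIV f} // add_const_rel" using S by blast
    have "{f. continuous_on UNIV f \<and> mod_const f \<in> S \<inter> T} =
        {f. continuous_on UNIV f \<and> mod_const f \<in> S} \<inter> {f. continuous_on UNIV f \<and> mod_const f \<in> T}"
      by blast
    then show "openin ucc_topology {f. continuous_on UNIV f \<and> mod_const f \<in> S \<inter> T}"
      using S T by (simp add: openin_Int)
  next
    fix \<K> assume *: "\<forall>U\<in>\<K>. ?P U"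
    then show "\<Union>\<K> \<subseteq> {f. continuous_on UNIV f} // add_const_rel" by blast
    have "{f. continuous_on UNIV f \<and> mod_const f \<in> \<Union>\<K>} =
        \<Union>((\<lambda>V. {f. continuous_on UNIV f \<and> mod_const f \<in> V}) ` \<K>)"
      by blast
    then show "openin ucc_topology {f. continuous_on UNIV f \<and> mod_const f \<in> \<Union>\<K>}"
      using * by (simp only:) (rule openin_Union, blast)
  qed
  then show ?thesis
    unfolding C_star_def by (simp add: topology_inverse')
qed

lemma topspace_C_star:
  "topspace C_star = {f :: 'y::topological_space \<Rightarrow> real. continuous_on UNIV f} // add_const_rel"
proof -
  have "{f :: 'y \<Rightarrow> real. continuous_on UNIV f \<and>
           mod_const f \<in> {f. continuous_on UNIV f} // add_const_rel} = topspace ucc_topology"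
    unfolding topspace_ucc_topology mod_const_def by (auto intro: quotientI)
  then have "openin C_star ({f :: 'y \<Rightarrow> real. continuous_on UNIV f} // add_const_rel)"
    unfolding openin_C_star by (metis openin_topspace order_refl)
  then show ?thesis
    unfolding topspace_def by (auto simp: openin_C_star)
qed

lemma quotient_map_mod_const: "quotient_map ucc_topology C_star mod_const"
  unfolding quotient_map_def
proof (intro conjI allI impI)
  show *: "mod_const ` topspace ucc_topology = topspace C_star"
    unfolding topspace_ucc_topology topspace_C_star mod_const_def quotient_def by auto
  fix U :: "('a \<Rightarrow> real) set set" assume "U \<subseteq> topspace C_star"
  then show "openin ucc_topology {x \<in> topspace ucc_topology. mod_const x \<in> U} = openin C_star U"
    by (simp add: openin_C_star topspace_C_star topspace_ucc_topology)
qed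

text \<open>In the following definitions \<open>d\<close> is meant to be a metric that induces the topology of the
  type \<open>'y\<close>. It is a separate argument because the library metric of a product type is the
  Euclidean one, not the maximum metric.\<close>

definition horo_embed ::
    "('y::topological_space \<Rightarrow> 'y \<Rightarrow> real) \<Rightarrow> 'y \<Rightarrow> ('y \<Rightarrow> real) set" where
  "horo_embed d y = mod_const (\<lambda>x. d y x)"

definition horo_compactification ::
    "('y::topological_space \<Rightarrow> 'y \<Rightarrow> real) \<Rightarrow> ('y \<Rightarrow> real) set set" where
  "horo_compactification d = C_star closure_of (range (horo_embed d))"

definition ideal_boundary ::
    "('y::topological_space \<Rightarrow> 'y \<Rightarrow> real) \<Rightarrow> ('y \<Rightarrow> real) set set" where
  "ideal_boundary d = horo_compactification d - range (horo_embed d)"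

text \<open>The action of an isometry \<open>\<phi>\<close> sends the class of \<open>f\<close> to the class of \<open>f \<circ> \<phi>\<^sup>-\<^sup>1\<close>.
  It extends \<open>\<phi>\<close> along \<open>horo_embed\<close>, see \<open>horo_act_embed\<close>.\<close>

definition horo_act ::
    "('y::topological_space \<Rightarrow> 'y) \<Rightarrow> ('y \<Rightarrow> real) set \<Rightarrow> ('y \<Rightarrow> real) set" where
  "horo_act \<phi> \<xi> = (\<lambda>f. f \<circ> inv_into UNIV \<phi>) ` \<xi>"

lemma horo_act_mod_const:
  fixes \<phi> :: "'y::topological_space \<Rightarrow> 'y"
  assumes "bij \<phi>" "continuous_on UNIV \<phi>" "continuous_on UNIV (inv_into UNIV \<phi>)" "continuous_on UNIV f"
  shows "horo_act \<phi> (mod_const f) = mod_const (f \<circ> inv_into UNIV \<phi>)"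
proof (intro equalityI subsetI)
  have comp: "continuous_on UNIV (g \<circ> h)"
    if "continuous_on UNIV g" "continuous_on UNIV h" for g :: "'y \<Rightarrow> real" and h
    using that by (metis continuous_on_compose continuous_on_subset subset_UNIV)
  fix g assume "g \<in> horo_act \<phi> (mod_const f)"
  then show "g \<in> mod_const (f \<circ> inv_into UNIV \<phi>)"
    using assms comp by (auto simp: horo_act_def mod_const_def add_const_rel_def)
next
  have comp: "continuous_on UNIV (g \<circ> h)"
    if "continuous_on UNIV g" "continuous_on UNIV h" for g :: "'y \<Rightarrow> real" and h
    using that by (metis continuous_on_compose continuous_on_subset subset_UNIV)
  fix g assume g: "g \<in> mod_const (f \<circ> inv_into UNIV \<phi>)"
  have "g \<circ> \<phi> \<in> mod_const f"
    using g assms comp bij_is_inj[OF assms(1)]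
    by (auto simp: mod_const_def add_const_rel_def inv_f_f)
  moreover have "g = (g \<circ> \<phi>) \<circ> inv_into UNIV \<phi>"
    using bij_is_surj[OF assms(1)] by (auto simp: fun_eq_iff surj_f_inv_f)
  ultimately show "g \<in> horo_act \<phi> (mod_const f)"
    unfolding horo_act_def by blast
qed

lemma horo_act_embed:
  fixes \<phi> :: "'y::topological_space \<Rightarrow> 'y"
  assumes "bij \<phi>" "continuous_on UNIV \<phi>" "continuous_on UNIV (inv_into UNIV \<phi>)"
    and "continuous_on UNIV (d y)" and "\<And>x x'. d (\<phi> x) (\<phi> x') = d x x'"
  shows "horo_act \<phi> (horo_embed d y) = horo_embed d (\<phi> y)"
proof -
  have "d y \<circ> inv_into UNIV \<phi> = d (\<phi> y)"
    using assms(5)[of y] bij_is_surj[OF assms(1)] by (auto simp: fun_eq_iff) (metis surj_f_inv_f)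
  then show ?thesis
    using horo_act_mod_const[OF assms(1-3), of "d y"] assms(4) by (simp add: horo_embed_def)
qed

definition d_max :: "'a::metric_space \<times> 'b::metric_space \<Rightarrow> 'a \<times> 'b \<Rightarrow> real" where
  "d_max p q = max (dist (fst p) (fst q)) (dist (snd p) (snd q))"

lemma Metric_space_d_max: "Metric_space UNIV d_max"
proof
  fix p q r :: "'a::metric_space \<times> 'b::metric_space"
  show "0 \<le> d_max p q" "d_max p q = d_max q p"
    by (auto simp: d_max_def dist_commute le_max_iff_disj)
  show "d_max p q = 0 \<longleftrightarrow> p = q"
  proof
    assume "d_max p q = 0"
    then have "dist (fst p) (fst q) \<le> 0" "dist (snd p) (snd q) \<le> 0"
      unfolding d_max_def by linarith+
    then show "p = q" by (simp add: prod_eq_iff)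
  qed (simp add: d_max_def)
  show "d_max p r \<le> d_max p q + d_max q r"
    using dist_triangle[of "fst p" "fst r" "fst q"] dist_triangle[of "snd p" "snd r" "snd q"]
    unfolding d_max_def by linarith
qed

lemma mtopology_d_max:
  "Metric_space.mtopology UNIV d_max =
     (euclidean :: ('a::metric_space \<times> 'b::metric_space) topology)"
proof -
  interpret M: Metric_space "UNIV :: ('a \<times> 'b) set" d_max by (rule Metric_space_d_max)
  have le: "d_max p q \<le> dist p q" for p q :: "'a \<times> 'b"
    unfolding d_max_def using dist_fst_le[of p q] dist_snd_le[of p q] by simp
  have ge: "dist p q \<le> 2 * d_max p q" for p q :: "'a \<times> 'b"
  proof -
    have "dist p q \<le> dist (fst p) (fst q) + dist (snd p) (snd q)"
      by (metis dist_prod_def sqrt_sum_squares_le_sum zero_le_dist)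
    then show ?thesis unfolding d_max_def by linarith
  qed
  have "openin M.mtopology U = open U" for U
  proof
    assume U: "openin M.mtopology U"
    show "open U" unfolding open_dist
    proof
      fix x assume "x \<in> U"
      then obtain r where r: "r > 0" "M.mball x r \<subseteq> U" using U M.openin_mtopology by metis
      have "y \<in> U" if "dist y x < r" for y
      proof -
        have "d_max x y < r" using le[of x y] that by (simp add: dist_commute)
        then show ?thesis using r(2) by (auto simp: M.mball_def)
      qed
      then show "\<exists>e>0. \<forall>y. dist y x < e \<longrightarrow> y \<in> U" using r(1) by blast
    qed
  next
    assume U: "open U"
    show "openin M.mtopology U" unfolding M.openin_mtopology
    proof (intro conjI allI impI)
      fix x assume "x \<in> U"
      then obtain e where e: "e > 0" "\<And>y. dist y x < e \<Longrightarrow> y \<in> U" using U unfolding open_dist by metis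
      have "M.mball x (e/2) \<subseteq> U"
      proof
        fix y assume "y \<in> M.mball x (e/2)"
        then have "2 * d_max x y < e" by simp
        then show "y \<in> U" using ge[of x y] e(2)[of y] by (simp add: dist_commute)
      qed
      then show "\<exists>r>0. M.mball x r \<subseteq> U" using e(1) by (intro exI[of _ "e/2"]) simp
    qed simp
  qed
  then show ?thesis by (simp add: topology_eq)
qed


section \<open>Isometry groups and actions\<close>

definition Isom :: "('a::metric_space \<Rightarrow> 'a) monoid" where
  "Isom = \<lparr>carrier = {f. surj f \<and> (\<forall>x y. dist (f x) (f y) = dist x y)}, mult = (\<circ>), one = id\<rparr>"

lemma group_Isom: "group (Isom :: ('a::metric_space \<Rightarrow> 'a) monoid)"
proof (rule groupI)
  fix f :: "'a \<Rightarrow> 'a" assume "f \<in> carrier Isom"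
  then have f: "surj f" "\<And>x y. dist (f x) (f y) = dist x y" by (auto simp: Isom_def)
  then have "inj f" by (metis dist_eq_0_iff injI)
  then have "inv_into UNIV f \<in> carrier Isom \<and> inv_into UNIV f \<circ> f = id"
    using f by (auto simp: Isom_def inj_imp_surj_inv) (metis surj_f_inv_f)
  then show "\<exists>g\<in>carrier Isom. g \<otimes>\<^bsub>Isom\<^esub> f = \<one>\<^bsub>Isom\<^esub>" by (auto simp: Isom_def)
next
  fix f g :: "'a \<Rightarrow> 'a" assume "f \<in> carrier Isom" "g \<in> carrier Isom"
  then show "f \<otimes>\<^bsub>Isom\<^esub> g \<in> carrier Isom"
    using comp_surj[of g f] by (simp add: Isom_def)
qed (auto simp: Isom_def comp_assoc)

definition Isom_topology :: "('a::metric_space \<Rightarrow> 'a) topology" where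
  "Isom_topology = subtopology ucc_topology (carrier Isom)"

definition discrete_rep :: "('g, 'm) monoid_scheme \<Rightarrow> ('g \<Rightarrow> 'a::metric_space \<Rightarrow> 'a) \<Rightarrow> bool" where
  "discrete_rep G \<rho> \<longleftrightarrow>
     subtopology Isom_topology (\<rho> ` carrier G) = discrete_topology (\<rho> ` carrier G)"

definition properly_discontinuous_action ::
    "('g, 'm) monoid_scheme \<Rightarrow> 'z topology \<Rightarrow> ('g \<Rightarrow> 'z \<Rightarrow> 'z) \<Rightarrow> bool" where
  "properly_discontinuous_action G Z act \<longleftrightarrow>
     (\<forall>K. compactin Z K \<longrightarrow> finite {\<gamma> \<in> carrier G. act \<gamma> ` K \<inter> K \<noteq> {}})"

definition cocompact_action ::
    "('g, 'm) monoid_scheme \<Rightarrow> 'z topology \<Rightarrow> ('g \<Rightarrow> 'z \<Rightarrow> 'z) \<Rightarrow> bool" where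
  "cocompact_action G Z act \<longleftrightarrow>
     (\<exists>K. compactin Z K \<and> topspace Z \<subseteq> (\<Union>\<gamma>\<in>carrier G. act \<gamma> ` K))"

definition coarsely_equivalent ::
    "('g, 'm) monoid_scheme \<Rightarrow> ('g \<Rightarrow> 'a::metric_space \<Rightarrow> 'a) \<Rightarrow>
     ('g \<Rightarrow> 'b::metric_space \<Rightarrow> 'b) \<Rightarrow> bool" where
  "coarsely_equivalent G \<rho>\<^sub>1 \<rho>\<^sub>2 \<longleftrightarrow>
     (\<exists>C>0. \<exists>p p'. \<forall>\<gamma>\<in>carrier G. \<forall>\<gamma>'\<in>carrier G.
        \<bar>dist (\<rho>\<^sub>1 \<gamma> p) (\<rho>\<^sub>1 \<gamma>' p) - dist (\<rho>\<^sub>2 \<gamma> p') (\<rho>\<^sub>2 \<gamma>' p')\<bar> \<le> C)"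

definition product_action ::
    "('g \<Rightarrow> 'a::metric_space \<Rightarrow> 'a) \<Rightarrow> ('g \<Rightarrow> 'b::metric_space \<Rightarrow> 'b) \<Rightarrow>
     'g \<Rightarrow> ('a \<times> 'b \<Rightarrow> real) set \<Rightarrow> ('a \<times> 'b \<Rightarrow> real) set" where
  "product_action \<rho>\<^sub>1 \<rho>\<^sub>2 \<gamma> = horo_act (map_prod (\<rho>\<^sub>1 \<gamma>) (\<rho>\<^sub>2 \<gamma>))"


section \<open>Hyperbolic groups\<close>

text \<open>Gromov's definition: the word metric of some finite generating set satisfies the four-point
  condition.\<close>

definition word_length :: "('g, 'm) monoid_scheme \<Rightarrow> 'g set \<Rightarrow> 'g \<Rightarrow> nat" where
  "word_length G S g = (LEAST n. \<exists>ws. length ws = n \<and> set ws \<subseteq> S \<union> m_inv G ` S \<and>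
     foldr (\<otimes>\<^bsub>G\<^esub>) ws \<one>\<^bsub>G\<^esub> = g)"

definition word_dist :: "('g, 'm) monoid_scheme \<Rightarrow> 'g set \<Rightarrow> 'g \<Rightarrow> 'g \<Rightarrow> real" where
  "word_dist G S g h = real (word_length G S (inv\<^bsub>G\<^esub> g \<otimes>\<^bsub>G\<^esub> h))"

definition gromov_product :: "('x \<Rightarrow> 'x \<Rightarrow> real) \<Rightarrow> 'x \<Rightarrow> 'x \<Rightarrow> 'x \<Rightarrow> real" where
  "gromov_product d w x y = (d w x + d w y - d x y) / 2"

definition gromov_hyperbolic_on :: "'x set \<Rightarrow> ('x \<Rightarrow> 'x \<Rightarrow> real) \<Rightarrow> bool" where
  "gromov_hyperbolic_on X d \<longleftrightarrow>
     (\<exists>\<delta>\<ge>0. \<forall>w\<in>X. \<forall>x\<in>X. \<forall>y\<in>X. \<forall>z\<in>X.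
        gromov_product d w x z \<ge> min (gromov_product d w x y) (gromov_product d w y z) - \<delta>)"

definition hyperbolic_group :: "('g, 'm) monoid_scheme \<Rightarrow> bool" where
  "hyperbolic_group G \<longleftrightarrow> group G \<and>
     (\<exists>S. finite S \<and> S \<subseteq> carrier G \<and> generate G S = carrier G \<and>
        gromov_hyperbolic_on (carrier G) (word_dist G S))"

end

theory Submission
  imports Defs
begin

text \<open>Fix a base point \<open>(p, q)\<close> of the product and let \<open>\<Gamma>\<close> act diagonally. The class
  \<open>[f]\<close> of a horofunction has a height function
  \<open>\<gamma> \<mapsto> f(\<gamma>(p, q)) - f(p, q)\<close> on the group. The domain \<open>\<Omega>\<close> consists of the boundary classes whose
  height function is proper, that is, has finite sublevel sets. (Geometrically these are the classes of
  \<open>max(b\<^sub>\<xi>, b\<^sub>\<eta> + c)\<close> for Busemann functions at boundary points \<open>\<xi>\<close>, \<open>\<eta>\<close> of the two factors that do not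
  correspond to each other under the equivariant identification of the two boundaries.) The height
  functions of the points of the product are proper as well, because a discrete representation with
  finite kernel moves the base point into a given ball by finitely many elements only (\<open>discrete_rep_finite_orbit_ball\<close>).

  Everything else follows from one inequality. In a CAT(-1) space, a distance function at a point
  between \<open>a\<close> and \<open>b\<close> is, up to a constant, at most the larger of its values at \<open>a\<close> and \<open>b\<close>, each
  lowered by the distance to that end (\<open>CAT_minus1_dist_to_quasi_between\<close>). Coarse equivalence makes a
  geodesic of the first factor, pushed to the orbit, a coarse geodesic of both factors at once, so the
  inequality holds for the maximum metric along the orbit in the product
  (\<open>coarsely_equivalent_orbit_interpolation\<close>); being a closed condition, it extends to all
  horofunctions (\<open>height_quasiconvex\<close>). It has two consequences.

  If the height of a class is large on a big sphere of the group, then for all nearby classes it is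
  still large there, and it grows linearly outside the sphere. So properness is open, and the places
  where the minimum is attained are locally bounded (\<open>orbit_proper_locally_uniform\<close>). The latter gives
  proper discontinuity, since the minimum moves equivariantly.

  If the height is minimal at the identity, then it is automatically proper: at a distant point of
  small height, the midpoint would be lower than the minimum (\<open>centred_orbit_proper\<close>). The classes
  with minimum at the identity thus form a closed subset of the compactification, and all of them
  have proper height functions. As the compactification is compact (\<open>compactin_compactification\<close>) and every proper height
  function can be translated to have its minimum at the identity, the action is cocompact.\<close>

section \<open>Quasiconvexity of distance functions in CAT(-1) spaces\<close>

lemma hyp_dist_commute: "hyp_dist z w = hyp_dist w z"
  by (simp add: hyp_dist_def norm_minus_commute mult_ac)

lemma hyp_dist_vertical_eqI:
  assumes "v > 0" "r > 0" "A \<ge> 0" and "u\<^sup>2 + v\<^sup>2 + r\<^sup>2 = 2 * v * r * cosh A"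
  shows "hyp_dist (Complex u v) (Complex 0 r) = A"
proof -
  have "(cmod (Complex u v - Complex 0 r))\<^sup>2 = u\<^sup>2 + (v - r)\<^sup>2"
    by (simp add: cmod_power2)
  also have "\<dots> = 2 * v * r * (cosh A - 1)"
    using assms(4) by (simp add: power2_eq_square algebra_simps)
  finally have "1 + (cmod (Complex u v - Complex 0 r))\<^sup>2 / (2 * v * r) = cosh A"
    using assms(1,2) by simp
  then show ?thesis
    using assms(3) by (simp add: hyp_dist_def arcosh_cosh_real)
qed

lemma hyp_dist_vertical_line:
  "hyp_dist (Complex 0 (exp s)) (Complex 0 (exp t)) = \<bar>s - t\<bar>"
proof (rule hyp_dist_vertical_eqI)
  have *: "exp s * (exp t * exp (s - t)) = exp s ^ 2" "exp s * (exp t * exp (t - s)) = exp t ^ 2"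
    by (simp_all add: power2_eq_square flip: exp_add)
  have "(cosh \<bar>s - t\<bar> :: real) = (exp (s - t) + exp (t - s)) / 2"
    by (auto simp: cosh_def abs_if)
  then show "0\<^sup>2 + (exp s)\<^sup>2 + (exp t)\<^sup>2 = 2 * exp s * exp t * cosh \<bar>s - t\<bar>"
    using * by (simp add: algebra_simps)
qed auto

text \<open>Put the side of length \<open>s + t\<close> on the imaginary axis. For \<open>x' = u + i v\<close> the quantity
  \<open>e\<^sup>r cosh d(x', i e\<^sup>r) = (\<bar>x'\<bar>\<^sup>2 + e\<^sup>2\<^sup>r) / (2 v)\<close> is affine in \<open>e\<^sup>2\<^sup>r\<close>. Its values at \<open>r = 0\<close> and
  \<open>r = s + t\<close> therefore determine \<open>v\<close> and \<open>\<bar>x'\<bar>\<^sup>2\<close>, and then the distance to \<open>i e\<^sup>s\<close> as well, which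
  turns out to satisfy \<open>cosh D \<le> e\<^sup>-\<^sup>s cosh A + e\<^sup>-\<^sup>t cosh B\<close>. The constant \<open>ln 4\<close> comes from comparing
  \<open>cosh\<close> with \<open>exp\<close>.\<close>

lemma comparison_triangle_with_cevian:
  fixes A B s t :: real
  assumes "s \<ge> 0" "t \<ge> 0" "s + t > 0" and AB: "A \<ge> 0" "B \<ge> 0"
    and tri: "A \<le> B + (s + t)" "B \<le> A + (s + t)" "s + t \<le> A + B"
  obtains x' where "x' \<in> hyperbolic_plane"
    "hyp_dist x' (Complex 0 1) = A" "hyp_dist x' (Complex 0 (exp (s + t))) = B"
    "hyp_dist x' (Complex 0 (exp s)) \<le> max (A - s) (B - t) + ln 4"
proof -
  define L where "L = s + t"
  define E where "E = exp L"
  define a where "a = exp A"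
  define b where "b = exp B"
  define S where "S = exp s"
  define T where "T = exp t"
  have pos: "a \<ge> 1" "b \<ge> 1" "S \<ge> 1" "T \<ge> 1" and ET: "E = S * T"
    using assms by (auto simp: a_def b_def S_def T_def E_def L_def exp_add)
  have E1: "E > 1" using assms by (simp add: E_def L_def)
  have tri': "a \<le> b * E" "b \<le> a * E" "E \<le> a * b"
    using tri by (auto simp: a_def b_def E_def L_def simp flip: exp_add)
  have cA: "cosh A = (a + 1 / a) / 2" and cB: "cosh B = (b + 1 / b) / 2"
    by (auto simp: cosh_def a_def b_def exp_minus inverse_eq_divide)
  \<comment> \<open>\<open>v\<close> is obtained by subtracting the two distance equations for \<open>x'\<close>; \<open>N\<close> stands for \<open>\<bar>x'\<bar>\<^sup>2\<close>.
    The triangle inequalities give positivity of the denominator and \<open>v\<^sup>2 \<le> N\<close>.\<close>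
  define den where "den = 2 * (E * cosh B - cosh A)"
  have den_eq: "a * b * den = E * a * b\<^sup>2 + E * a - b * a\<^sup>2 - b"
    unfolding den_def cA cB using pos by (simp add: field_simps power2_eq_square)
  have "E * a * b\<^sup>2 + E * a - b * a\<^sup>2 - b = (a * b) * (b * E - a) + (E * a - b)"
    by (simp add: algebra_simps power2_eq_square)
  moreover have "\<dots> > 0"
  proof (cases "a = b * E")
    case True
    then have "E * a - b = b * (E * E - 1)" by (simp add: algebra_simps)
    moreover have "E * E > 1" using E1 less_1_mult by blast
    ultimately show ?thesis using True pos by simp
  next
    case False
    then have "(a * b) * (b * E - a) > 0" using tri'(1) pos by simp
    then show ?thesis using tri'(2) by (simp add: mult.commute)
  qed
  ultimately have "a * b * den > 0" using den_eq by simp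
  then have den: "den > 0" using zero_less_mult_pos[of "a * b" den] pos by simp
  define v where "v = (E\<^sup>2 - 1) / den"
  have v: "v > 0" using den E1 by (simp add: v_def)
  define N where "N = 2 * v * cosh A - 1"
  have NB: "N + E\<^sup>2 = 2 * v * E * cosh B"
    using den unfolding N_def v_def den_def by (simp add: field_simps)
  \<comment> \<open>\<open>N - v\<^sup>2\<close> is a quadratic polynomial in \<open>v\<close> with roots \<open>1/a\<close> and \<open>a\<close>.\<close>
  have quad: "v\<^sup>2 \<le> N"
  proof -
    have "v \<le> a"
    proof -
      have "b * (E\<^sup>2 - 1) \<le> b * (a * den)"
      proof -
        have "b * (a * den) - b * (E\<^sup>2 - 1) = (a * b - E) * (b * E - a)"
          using den_eq by (simp add: algebra_simps power2_eq_square)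
        also have "\<dots> \<ge> 0" using tri' by (intro mult_nonneg_nonneg) auto
        finally show ?thesis by simp
      qed
      then have "E\<^sup>2 - 1 \<le> a * den" using pos by (subst (asm) mult_le_cancel_left_pos) auto
      then show ?thesis using den by (simp add: v_def pos_divide_le_eq)
    qed
    moreover have "1 / a \<le> v"
    proof -
      have "b * den \<le> b * (a * (E\<^sup>2 - 1))"
      proof -
        have "a * (b * (a * (E\<^sup>2 - 1)) - b * den) = (a * E - b) * (a * (b * E) - 1)"
          using den_eq by (simp add: algebra_simps power2_eq_square)
        also have "\<dots> \<ge> 0"
        proof -
          have "1 \<le> b * E" using pos E1 mult_mono[of 1 b 1 E] by simp
          then have "1 \<le> a * (b * E)" using pos mult_mono[of 1 a 1 "b * E"] by simp
          then show ?thesis using tri' by (intro mult_nonneg_nonneg) auto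
        qed
        finally show ?thesis using pos by (simp add: zero_le_mult_iff)
      qed
      then have "den \<le> a * (E\<^sup>2 - 1)" using pos by (subst (asm) mult_le_cancel_left_pos) auto
      then show ?thesis using den pos by (simp add: v_def field_simps)
    qed
    ultimately have "(a - v) * (v - 1/a) \<ge> 0" by (intro mult_nonneg_nonneg) auto
    moreover have "(a - v) * (v - 1/a) = N - v\<^sup>2"
      unfolding N_def cA using pos by (simp add: field_simps power2_eq_square)
    ultimately show ?thesis by simp
  qed
  define x' where "x' = Complex (sqrt (N - v\<^sup>2)) v"
  have u: "(sqrt (N - v\<^sup>2))\<^sup>2 + v\<^sup>2 = N" using quad by simp
  have xA: "hyp_dist x' (Complex 0 1) = A"
    unfolding x'_def using v AB u by (intro hyp_dist_vertical_eqI) (auto simp: N_def)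
  have xB: "hyp_dist x' (Complex 0 (exp (s + t))) = B"
    unfolding x'_def using v AB u NB by (intro hyp_dist_vertical_eqI) (auto simp: E_def L_def)
  define c where "c = (N + S\<^sup>2) / (2 * v * S)"
  have c1: "c \<ge> 1"
  proof -
    have "2 * v * S \<le> v\<^sup>2 + S\<^sup>2" using sum_squares_bound[of v S] by simp
    then have "2 * v * S \<le> N + S\<^sup>2" using quad by simp
    then show ?thesis using v pos by (simp add: c_def)
  qed
  define D where "D = arcosh c"
  have D: "D \<ge> 0" "cosh D = c" using c1 by (auto simp: D_def cosh_arcosh_real)
  have xD: "hyp_dist x' (Complex 0 (exp s)) = D"
    unfolding x'_def using v pos u D
    by (intro hyp_dist_vertical_eqI) (auto simp: c_def S_def[symmetric])
  have "D \<le> max (A - s) (B - t) + ln 4"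
  proof -
    let ?M = "max (A - s) (B - t)"
    have "c * (2 * v * S) = N + S\<^sup>2" using v pos by (simp add: c_def)
    also have "\<dots> \<le> (N + 1) + (N + E\<^sup>2) / T\<^sup>2"
    proof -
      have "N \<ge> 0" using quad by (meson order_trans zero_le_power2)
      moreover have "(N + E\<^sup>2) / T\<^sup>2 = N / T\<^sup>2 + S\<^sup>2"
        using pos by (simp add: ET add_divide_distrib power_mult_distrib)
      ultimately show ?thesis by simp
    qed
    also have "\<dots> = (cosh A / S + cosh B / T) * (2 * v * S)"
      using NB pos by (simp add: N_def ET field_simps power2_eq_square)
    finally have "c \<le> cosh A / S + cosh B / T" using v pos by simp
    moreover have "cosh A \<le> a" using AB by (simp add: cosh_def a_def)
    moreover have "cosh B \<le> b" using AB by (simp add: cosh_def b_def)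
    ultimately have "c \<le> a / S + b / T"
      using pos divide_right_mono[of "cosh A" a S] divide_right_mono[of "cosh B" b T] by linarith
    also have "\<dots> = exp (A - s) + exp (B - t)"
      by (simp add: a_def b_def S_def T_def exp_diff)
    also have "\<dots> \<le> exp ?M + exp ?M" by (intro add_mono) auto
    finally have "cosh D \<le> 2 * exp ?M" using D by simp
    moreover have "exp D \<le> 2 * cosh D" by (simp add: cosh_def)
    ultimately have "exp D \<le> exp (?M + ln 4)" by (simp add: exp_add)
    then show ?thesis by simp
  qed
  then show ?thesis
    using that[of x'] xA xB xD v by (simp add: hyperbolic_plane_def x'_def)
qed

lemma CAT_minus1_geodesic:
  assumes "CAT_minus1 TYPE('a::metric_space)"
  obtains c where "geodesic_path c x (y::'a)"
  using assms unfolding CAT_minus1_def by blast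

lemma CAT_minus1_comparison:
  fixes x y z :: "'a::metric_space"
  assumes "CAT_minus1 TYPE('a)"
    and "geodesic_path c\<^sub>1 x y" "geodesic_path c\<^sub>2 x z" "geodesic_path c\<^sub>3 y z"
    and "p \<in> c\<^sub>1 ` {0..dist x y}" "q \<in> c\<^sub>2 ` {0..dist x z}"
    and "comparison_triangle x y z x' y' z'"
    and "comparison_point x y p x' y' p'" "comparison_point x z q x' z' q'"
  shows "dist p q \<le> hyp_dist p' q'"
  using assms(1)[unfolded CAT_minus1_def] assms(2-) by blast

lemma geodesic_path_dist:
  assumes "geodesic_path c x y" "0 \<le> r" "r \<le> dist x y"
  shows "dist x (c r) = r" "dist (c r) y = dist x y - r"
proof -
  have "dist (c 0) (c r) = \<bar>0 - r\<bar>" "dist (c r) (c (dist x y)) = \<bar>r - dist x y\<bar>"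
    using assms unfolding geodesic_path_def by (meson atLeastAtMost_iff order_refl zero_le_dist)+
  then show "dist x (c r) = r" "dist (c r) y = dist x y - r"
    using assms unfolding geodesic_path_def by auto
qed

text \<open>This is the form in which negative curvature is used: up to an additive constant, a distance
  function along a geodesic is the maximum of the two functions of slope \<open>-1\<close> and \<open>1\<close> that are
  fixed by its end values. Hence it is quasiconvex, and it grows at unit speed past any point
  where it is well above its value at the start. The inequality holds for the explicit triangle of
  \<open>comparison_triangle_with_cevian\<close> and is carried over by comparison.\<close>

lemma CAT_minus1_dist_to_geodesic:
  fixes a b x :: "'a::metric_space"
  assumes cat: "CAT_minus1 TYPE('a)"
    and c: "geodesic_path c a b" and r: "0 \<le> r" "r \<le> dist a b"
  shows "dist x (c r) \<le> max (dist x a - r) (dist x b - (dist a b - r)) + ln 4"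
proof (cases "dist a b = 0")
  case True
  then show ?thesis using c r by (auto simp: geodesic_path_def max_def)
next
  case False
  let ?p = "c r"
  have p: "dist a ?p = r" "dist ?p b = dist a b - r" using geodesic_path_dist[OF c r] by auto
  obtain x' where x': "x' \<in> hyperbolic_plane"
    "hyp_dist x' (Complex 0 1) = dist x a" "hyp_dist x' (Complex 0 (exp (dist a b))) = dist x b"
    "hyp_dist x' (Complex 0 (exp r)) \<le> max (dist x a - r) (dist x b - (dist a b - r)) + ln 4"
    using comparison_triangle_with_cevian[of r "dist a b - r" "dist x a" "dist x b"] r False
      dist_triangle[of x a b] dist_triangle[of x b a] dist_triangle[of a b x]
    by (auto simp: dist_commute)
  obtain c2 where c2: "geodesic_path c2 a x" using CAT_minus1_geodesic[OF cat] .
  obtain c3 where c3: "geodesic_path c3 b x" using CAT_minus1_geodesic[OF cat] .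
  let ?a' = "Complex 0 1" and ?b' = "Complex 0 (exp (dist a b))" and ?p' = "Complex 0 (exp r)"
  have line: "hyp_dist ?a' ?b' = dist a b" "hyp_dist ?a' ?p' = r" "hyp_dist ?p' ?b' = dist a b - r"
    using hyp_dist_vertical_line[of 0 "dist a b"] hyp_dist_vertical_line[of 0 r]
      hyp_dist_vertical_line[of r "dist a b"] r by auto
  have "hyp_dist x' x' = 0" by (simp add: hyp_dist_def)
  moreover have "?p \<in> c ` {0..dist a b}" using r by auto
  moreover have "x \<in> c2 ` {0..dist a x}"
    using c2 unfolding geodesic_path_def by (metis atLeastAtMost_iff imageI order_refl zero_le_dist)
  moreover have "comparison_triangle a b x ?a' ?b' x'"
    using x' line by (auto simp: comparison_triangle_def hyperbolic_plane_def hyp_dist_commute dist_commute)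
  moreover have "comparison_point a b ?p ?a' ?b' ?p'"
    using line p by (auto simp: comparison_point_def hyperbolic_plane_def)
  moreover have "comparison_point a x x ?a' x' x'"
    using x' \<open>hyp_dist x' x' = 0\<close> by (simp add: comparison_point_def hyp_dist_commute dist_commute)
  ultimately have "dist ?p x \<le> hyp_dist ?p' x'"
    by (intro CAT_minus1_comparison[OF cat c c2 c3])
  then show ?thesis using x'(4) by (simp add: dist_commute hyp_dist_commute)
qed

text \<open>The inequality for geodesics, applied with \<open>p\<close> in the role of \<open>x\<close>, shows that a point \<open>p\<close> which
  almost realises the triangle inequality between \<open>a\<close> and \<open>b\<close> is near a geodesic from \<open>a\<close> to \<open>b\<close>.
  Applied once more it gives the same kind of bound for \<open>p\<close>. This form
  mentions no geodesic, so it survives the passage from one factor of the product to the other.\<close>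

lemma CAT_minus1_dist_to_quasi_between:
  fixes a b p x :: "'a::metric_space"
  assumes cat: "CAT_minus1 TYPE('a)" and p: "dist a p + dist p b \<le> dist a b + k"
  shows "dist x p \<le> max (dist x a - dist a p) (dist x b - dist p b) + (2 * k + 3 * ln 4)"
proof -
  obtain c where c: "geodesic_path c a b" using CAT_minus1_geodesic[OF cat] .
  define r where "r = min (dist a p) (dist a b)"
  have r: "0 \<le> r" "r \<le> dist a b" by (auto simp: r_def)
  have q: "dist a (c r) = r" "dist (c r) b = dist a b - r" using geodesic_path_dist[OF c r] by auto
  have "dist a p - r \<le> k" "dist p b - (dist a b - r) \<le> k"
    using p dist_triangle[of a b p] zero_le_dist[of p b] unfolding r_def by linarith+
  then have pq: "dist p (c r) \<le> k + ln 4"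
    using CAT_minus1_dist_to_geodesic[OF cat c r, of p] by (auto simp: dist_commute)
  have "dist x p \<le> dist x (c r) + dist p (c r)" by (metis dist_triangle dist_commute)
  moreover have "dist a p \<le> r + dist p (c r)" "dist p b \<le> dist p (c r) + (dist a b - r)"
    using q dist_triangle[of a p "c r"] dist_triangle[of p b "c r"] by (auto simp: dist_commute)
  ultimately show ?thesis using CAT_minus1_dist_to_geodesic[OF cat c r, of x] pq by linarith
qed

section \<open>Horofunctions modulo constants\<close>

lemma mod_const_eq_iff:
  assumes "continuous_on UNIV f" "continuous_on UNIV g"
  shows "mod_const f = mod_const g \<longleftrightarrow> (\<exists>c. \<forall>x. g x = f x + c)"
  using eq_equiv_class_iff[OF equiv_add_const_rel, of f g] assms
  by (simp add: mod_const_def add_const_rel_def)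

lemma topspace_C_star_cases:
  assumes "\<xi> \<in> topspace C_star"
  obtains f where "continuous_on UNIV f" "\<xi> = mod_const f"
  using assms unfolding topspace_C_star quotient_def mod_const_def by auto

lemma mod_const_in_topspace: "continuous_on UNIV f \<Longrightarrow> mod_const f \<in> topspace C_star"
  unfolding topspace_C_star mod_const_def by (auto intro: quotientI)

text \<open>The difference of two values does not depend on the representative of a class modulo constants,
  so the choice below is immaterial on points of the quotient space. All conditions on horofunctions
  that occur later are stated through these differences, which are continuous in the class.\<close>

definition horo_diff :: "('y::topological_space \<Rightarrow> real) set \<Rightarrow> 'y \<Rightarrow> 'y \<Rightarrow> real" where
  "horo_diff \<xi> x y = (let f = SOME f. f \<in> \<xi> in f x - f y)"

lemma horo_diff_mod_const:
  assumes "continuous_on UNIV f"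
  shows "horo_diff (mod_const f) x y = f x - f y"
proof -
  have "f \<in> mod_const f"
    using assms by (auto simp: mod_const_def add_const_rel_def intro: exI[of _ 0])
  then have "(SOME g. g \<in> mod_const f) \<in> mod_const f" by (metis someI)
  then show ?thesis
    by (auto simp: horo_diff_def Let_def mod_const_def add_const_rel_def)
qed

lemma horo_diff_split:
  assumes "\<xi> \<in> topspace C_star"
  shows "horo_diff \<xi> x z = horo_diff \<xi> x y + horo_diff \<xi> y z"
proof -
  obtain f where "continuous_on UNIV f" "\<xi> = mod_const f" using topspace_C_star_cases[OF assms] .
  then show ?thesis by (simp add: horo_diff_mod_const)
qed

lemma continuous_map_horo_diff:
  "continuous_map C_star euclideanreal (\<lambda>\<xi>. horo_diff \<xi> x y)"
proof (rule continuous_compose_quotient_map[OF quotient_map_mod_const])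
  have "continuous_map ucc_topology euclideanreal (\<lambda>f::'a \<Rightarrow> real. f x - f y)"
    unfolding continuous_map_def
  proof (intro conjI allI impI)
    fix U :: "real set" assume "openin euclideanreal U"
    then have U: "open U" by simp
    show "openin ucc_topology {f \<in> topspace ucc_topology. f x - f y \<in> U}"
      unfolding openin_ucc_topology
    proof (intro conjI ballI)
      fix f :: "'a \<Rightarrow> real" assume "f \<in> {f \<in> topspace ucc_topology. f x - f y \<in> U}"
      then obtain e where e: "e > 0" "\<And>r. dist r (f x - f y) < e \<Longrightarrow> r \<in> U"
        using U unfolding open_dist by auto
      have "g x - g y \<in> U" if "g \<in> ucc_nhd f {x, y} (e / 2)" for g
      proof (rule e(2))
        have "\<bar>f x - g x\<bar> < e / 2" "\<bar>f y - g y\<bar> < e / 2"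
          using that by (auto simp: ucc_nhd_def dist_real_def)
        then show "dist (g x - g y) (f x - f y) < e" unfolding dist_real_def by linarith
      qed
      then have "ucc_nhd f {x, y} (e / 2) \<subseteq> {f \<in> topspace ucc_topology. f x - f y \<in> U}"
        by (auto simp: topspace_ucc_topology ucc_nhd_def)
      then show "\<exists>K \<epsilon>. compact K \<and> \<epsilon> > 0 \<and>
          ucc_nhd f K \<epsilon> \<subseteq> {f \<in> topspace ucc_topology. f x - f y \<in> U}"
        using e(1) by (intro exI[of _ "{x, y}"] exI[of _ "e / 2"]) auto
    qed (auto simp: topspace_ucc_topology)
  qed simp
  then show "continuous_map ucc_topology euclideanreal ((\<lambda>\<xi>. horo_diff \<xi> x y) \<circ> mod_const)"
    by (rule continuous_map_eq) (simp add: topspace_ucc_topology horo_diff_mod_const)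
qed

lemma continuous_map_horo_act:
  fixes \<phi> :: "'y::topological_space \<Rightarrow> 'y"
  assumes \<phi>: "bij \<phi>" "continuous_on UNIV \<phi>" "continuous_on UNIV (inv_into UNIV \<phi>)"
  shows "continuous_map C_star C_star (horo_act \<phi>)"
proof (rule continuous_compose_quotient_map[OF quotient_map_mod_const])
  let ?\<psi> = "inv_into UNIV \<phi>"
  have comp: "continuous_on UNIV (f \<circ> ?\<psi>)" if "continuous_on UNIV f" for f :: "'y \<Rightarrow> real"
    using that \<phi>(3) by (metis continuous_on_compose continuous_on_subset subset_UNIV)
  have "continuous_map ucc_topology ucc_topology (\<lambda>f::'y \<Rightarrow> real. f \<circ> ?\<psi>)"
    unfolding continuous_map_def
  proof (intro conjI allI impI)
    fix U :: "('y \<Rightarrow> real) set" assume U: "openin ucc_topology U"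
    show "openin ucc_topology {f \<in> topspace ucc_topology. f \<circ> ?\<psi> \<in> U}"
      unfolding openin_ucc_topology
    proof (intro conjI ballI)
      fix f assume "f \<in> {f \<in> topspace ucc_topology. f \<circ> ?\<psi> \<in> U}"
      then obtain K e where K: "compact K" "e > 0" "ucc_nhd (f \<circ> ?\<psi>) K e \<subseteq> U"
        using U unfolding openin_ucc_topology by blast
      have "ucc_nhd f (?\<psi> ` K) e \<subseteq> {f \<in> topspace ucc_topology. f \<circ> ?\<psi> \<in> U}"
        using K(3) comp by (auto simp: ucc_nhd_def topspace_ucc_topology)
      moreover have "compact (?\<psi> ` K)"
        using K(1) \<phi>(3) by (meson compact_continuous_image continuous_on_subset subset_UNIV)
      ultimately show "\<exists>K \<epsilon>. compact K \<and> \<epsilon> > 0 \<and>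
          ucc_nhd f K \<epsilon> \<subseteq> {f \<in> topspace ucc_topology. f \<circ> ?\<psi> \<in> U}"
        using K(2) by blast
    qed (auto simp: topspace_ucc_topology)
  qed (use comp in \<open>auto simp: topspace_ucc_topology comp_def\<close>)
  then have "continuous_map ucc_topology C_star (mod_const \<circ> (\<lambda>f. f \<circ> ?\<psi>))"
    using quotient_imp_continuous_map[OF quotient_map_mod_const] continuous_map_compose by blast
  then show "continuous_map ucc_topology C_star (horo_act \<phi> \<circ> mod_const)"
    by (rule continuous_map_eq) (simp add: topspace_ucc_topology horo_act_mod_const[OF \<phi>])
qed

lemma horo_diff_horo_act:
  fixes \<phi> :: "'y::topological_space \<Rightarrow> 'y"
  assumes \<phi>: "bij \<phi>" "continuous_on UNIV \<phi>" "continuous_on UNIV (inv_into UNIV \<phi>)"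
    and "\<xi> \<in> topspace C_star"
  shows "horo_diff (horo_act \<phi> \<xi>) (\<phi> x) (\<phi> y) = horo_diff \<xi> x y"
proof -
  obtain f where f: "continuous_on UNIV f" "\<xi> = mod_const f"
    using topspace_C_star_cases[OF assms(4)] .
  have "continuous_on UNIV (f \<circ> inv_into UNIV \<phi>)"
    using f \<phi>(3) by (metis continuous_on_compose continuous_on_subset subset_UNIV)
  then show ?thesis
    using f bij_is_inj[OF \<phi>(1)] by (simp add: horo_act_mod_const[OF \<phi>] horo_diff_mod_const inv_f_f)
qed

lemma horo_act_id: "horo_act id \<xi> = \<xi>"
  by (simp add: horo_act_def)

lemma horo_act_comp:
  assumes "bij \<phi>" "bij \<psi>"
  shows "horo_act (\<phi> \<circ> \<psi>) \<xi> = horo_act \<phi> (horo_act \<psi> \<xi>)"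
  using assms by (simp add: horo_act_def o_inv_distrib image_image comp_assoc)

section \<open>Compactness of the horofunction compactification\<close>

locale topological_metric =
  fixes d :: "'y::topological_space \<Rightarrow> 'y \<Rightarrow> real"
  assumes metric: "Metric_space UNIV d"
    and mtopology: "Metric_space.mtopology UNIV d = euclidean"
begin

sublocale M: Metric_space UNIV d by (rule metric)

lemma lipschitz_imp_continuous:
  assumes "\<And>x y. f x - f y \<le> d x y"
  shows "continuous_on UNIV (f :: 'y \<Rightarrow> real)"
proof -
  have "continuous_map M.mtopology euclideanreal f"
    unfolding continuous_map_def
  proof (intro conjI allI impI)
    fix U :: "real set" assume "openin euclideanreal U"
    then have U: "open U" by simp
    show "openin M.mtopology {x \<in> topspace M.mtopology. f x \<in> U}"
      unfolding M.openin_mtopology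
    proof (intro conjI allI impI)
      fix x assume "x \<in> {x \<in> topspace M.mtopology. f x \<in> U}"
      then obtain e where e: "e > 0" "\<And>r. dist r (f x) < e \<Longrightarrow> r \<in> U"
        using U unfolding open_dist by auto
      have "f y \<in> U" if "d x y < e" for y
        using assms[of x y] assms[of y x] M.commute[of x y] that
        by (intro e(2)) (simp add: dist_real_def)
      then show "\<exists>r>0. M.mball x r \<subseteq> {x \<in> topspace M.mtopology. f x \<in> U}"
        using e(1) by (intro exI[of _ e]) auto
    qed auto
  qed simp
  then show ?thesis by (simp add: mtopology)
qed

lemma isometry_continuous:
  assumes "\<And>x y. d (f x) (f y) = d x y"
  shows "continuous_on UNIV f"
proof -
  have "continuous_map M.mtopology M.mtopology f"
    unfolding M.continuous_map_to_metric
  proof (intro ballI allI impI)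
    fix x and e :: real assume "e > 0"
    then show "\<exists>U. openin M.mtopology U \<and> x \<in> U \<and> (\<forall>y\<in>U. f y \<in> M.mball (f x) e)"
      using assms by (intro exI[of _ "M.mball x e"]) auto
  qed
  then show ?thesis by (simp add: mtopology)
qed

lemma continuous_dist: "continuous_on UNIV (d y)"
proof (rule lipschitz_imp_continuous)
  show "d y x - d y x' \<le> d x x'" for x x'
    using M.triangle[of y x' x] M.commute[of x x'] by simp
qed

lemma horo_diff_embed: "horo_diff (horo_embed d q) x y = d q x - d q y"
  unfolding horo_embed_def using continuous_dist by (simp add: horo_diff_mod_const)

lemma horo_embed_in_topspace: "range (horo_embed d) \<subseteq> topspace C_star"
  unfolding horo_embed_def using continuous_dist mod_const_in_topspace by blast

lemma range_subset_compactification: "range (horo_embed d) \<subseteq> horo_compactification d"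
  unfolding horo_compactification_def by (simp add: closure_of_subset horo_embed_in_topspace)

lemma compactification_subset_topspace: "horo_compactification d \<subseteq> topspace C_star"
  unfolding horo_compactification_def by (rule closure_of_subset_topspace)

text \<open>A weak inequality between continuous functions of a class that holds for all points of the space
  persists for all horofunctions.\<close>

lemma compactification_closed_condition:
  assumes "continuous_map C_star euclideanreal F" "\<And>q. F (horo_embed d q) \<le> 0"
    and "\<xi> \<in> horo_compactification d"
  shows "F \<xi> \<le> 0"
proof -
  let ?S = "{\<xi> \<in> topspace C_star. F \<xi> \<in> {..0}}"
  have "closedin C_star ?S"
    by (rule closedin_continuous_map_preimage[OF assms(1)]) simp
  moreover have "range (horo_embed d) \<subseteq> ?S"
    using assms(2) horo_embed_in_topspace by auto
  ultimately have "horo_compactification d \<subseteq> ?S"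
    unfolding horo_compactification_def by (rule closure_of_minimal[rotated])
  then show ?thesis using assms(3) by auto
qed

lemma horo_diff_lipschitz:
  assumes "\<xi> \<in> horo_compactification d"
  shows "horo_diff \<xi> x y \<le> d x y"
proof -
  have "horo_diff \<xi> x y - d x y \<le> 0"
  proof (rule compactification_closed_condition[OF _ _ assms])
    show "continuous_map C_star euclideanreal (\<lambda>\<xi>. horo_diff \<xi> x y - d x y)"
      by (intro continuous_intros continuous_map_horo_diff)
  qed (use M.triangle[of _ y x] in \<open>auto simp: horo_diff_embed M.commute algebra_simps\<close>)
  then show ?thesis by simp
qed

lemma horo_act_compactification:
  assumes \<phi>: "bij \<phi>" "continuous_on UNIV \<phi>" "continuous_on UNIV (inv_into UNIV \<phi>)"
    and iso: "\<And>x y. d (\<phi> x) (\<phi> y) = d x y"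
    and "\<xi> \<in> horo_compactification d"
  shows "horo_act \<phi> \<xi> \<in> horo_compactification d"
proof -
  have "horo_act \<phi> ` range (horo_embed d) \<subseteq> range (horo_embed d)"
    using horo_act_embed[where d = d, OF \<phi> continuous_dist iso] by auto
  then have "C_star closure_of (horo_act \<phi> ` range (horo_embed d)) \<subseteq> horo_compactification d"
    unfolding horo_compactification_def by (rule closure_of_mono)
  moreover have "horo_act \<phi> \<xi> \<in> C_star closure_of (horo_act \<phi> ` range (horo_embed d))"
    using continuous_map_image_closure_subset[OF continuous_map_horo_act[OF \<phi>]] assms(5)
    unfolding horo_compactification_def by blast
  ultimately show ?thesis by blast
qed

lemma finite_net:
  assumes "compact K" "e > 0"
  obtains F where "finite F" "\<And>x. x \<in> K \<Longrightarrow> \<exists>y\<in>F. d x y < e"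
proof -
  have "compactin M.mtopology K" using assms(1) by (simp add: mtopology)
  then have "M.mtotally_bounded K" by (rule M.compactin_imp_mtotally_bounded)
  then obtain F where "finite F" "K \<subseteq> (\<Union>x\<in>F. M.mball x e)"
    using assms(2) unfolding M.mtotally_bounded_def by blast
  then have "\<exists>y\<in>F. d x y < e" if x: "x \<in> K" for x
  proof -
    obtain y where "y \<in> F" "x \<in> M.mball y e" using x \<open>K \<subseteq> _\<close> by blast
    then show ?thesis using M.commute[of y x] by auto
  qed
  then show ?thesis using that \<open>finite F\<close> by blast
qed

text \<open>Normalised at a point, the functions of Lipschitz constant one form a closed subset of a product of
  compact intervals, so they are compact for pointwise convergence. On this equicontinuous family
  pointwise convergence implies uniform convergence on compact sets, so the classes of these functions
  form a compact set in the quotient; it contains the compactification, which is closed.\<close>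

lemma compactin_compactification: "compactin C_star (horo_compactification d)"
proof -
  fix z :: 'y
  define L where "L = {f. f z = 0 \<and> (\<forall>x y. f x - f y \<le> d x y)}"
  have L_lip: "f x - f y \<le> d x y" if "f \<in> L" for f x y
    using that by (simp add: L_def)
  have cont: "continuous_on UNIV f" if "f \<in> L" for f
    using L_lip[OF that] by (rule lipschitz_imp_continuous)
  have "compact L"
  proof -
    have "compactin (product_topology (\<lambda>_. euclidean) UNIV) (PiE UNIV (\<lambda>x. {- d x z..d x z}))"
      by (simp add: compactin_PiE)
    then have "compact (PiE UNIV (\<lambda>x. {- d x z..d x z}))"
      by (simp add: euclidean_product_topology)
    moreover have "closed L"
    proof -
      have ev: "continuous_on UNIV (\<lambda>f :: 'y \<Rightarrow> real. f x)" for x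
        by (intro continuous_on_product_coordinates)
      have "closed {f :: 'y \<Rightarrow> real. f z = 0}"
        by (intro closed_Collect_eq ev continuous_on_const)
      moreover have "closed {f :: 'y \<Rightarrow> real. \<forall>x y. f x - f y \<le> d x y}"
        by (intro closed_Collect_all closed_Collect_le continuous_on_diff ev continuous_on_const)
      ultimately show ?thesis unfolding L_def by (simp add: Collect_conj_eq closed_Int)
    qed
    moreover have "L \<subseteq> PiE UNIV (\<lambda>x. {- d x z..d x z})"
    proof
      fix f assume "f \<in> L"
      then have f: "f z = 0" "f x - f y \<le> d x y" for x y by (auto simp: L_def)
      have "f x \<in> {- d x z..d x z}" for x
        using f(1) f(2)[of x z] f(2)[of z x] M.commute[of z x] by simp
      then show "f \<in> PiE UNIV (\<lambda>x. {- d x z..d x z})" by auto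
    qed
    ultimately show ?thesis by (metis compact_Int_closed inf.absorb_iff2)
  qed
  moreover have "continuous_map (top_of_set L) C_star mod_const"
  proof -
    have "continuous_map (top_of_set L) ucc_topology (\<lambda>f. f)"
      unfolding continuous_map_def
    proof (intro conjI allI impI)
      fix U :: "('y \<Rightarrow> real) set" assume U: "openin ucc_topology U"
      show "openin (top_of_set L) {f \<in> topspace (top_of_set L). f \<in> U}"
      proof (subst openin_subopen, intro ballI)
        fix f assume "f \<in> {f \<in> topspace (top_of_set L). f \<in> U}"
        then have f: "f \<in> L" "f \<in> U" by auto
        then obtain K e where K: "compact K" "e > 0" "ucc_nhd f K e \<subseteq> U"
          using U unfolding openin_ucc_topology by blast
        obtain F where F: "finite F" "\<And>x. x \<in> K \<Longrightarrow> \<exists>y\<in>F. d x y < e / 3"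
          using finite_net[OF K(1), of "e / 3"] K(2) by auto
        define W where "W = (\<Inter>y\<in>F. {g. \<bar>g y - f y\<bar> < e / 3})"
        have "open W"
          unfolding W_def using F(1)
          by (intro open_INT ballI open_Collect_less continuous_intros continuous_on_product_coordinates) auto
        moreover have "f \<in> W" using K(2) by (simp add: W_def)
        moreover have "g \<in> U" if g: "g \<in> L" "g \<in> W" for g
        proof -
          have "dist (f x) (g x) < e" if x: "x \<in> K" for x
          proof -
            obtain y where y: "y \<in> F" "d x y < e / 3" using F(2)[OF x] by blast
            have "\<bar>g y - f y\<bar> < e / 3" using g(2) y(1) by (auto simp: W_def)
            moreover have "f x - f y \<le> d x y" "f y - f x \<le> d x y"
              "g x - g y \<le> d x y" "g y - g x \<le> d x y"
              using L_lip[OF f(1), of x y] L_lip[OF f(1), of y x] L_lip[OF g(1), of x y]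
                L_lip[OF g(1), of y x] M.commute[of x y] by simp_all
            ultimately show ?thesis using y(2) unfolding dist_real_def by linarith
          qed
          then show ?thesis using K(3) cont[OF g(1)] by (auto simp: ucc_nhd_def)
        qed
        ultimately show "\<exists>T. openin (top_of_set L) T \<and> f \<in> T \<and> T \<subseteq> {f \<in> topspace (top_of_set L). f \<in> U}"
          using f(1) by (intro exI[of _ "L \<inter> W"]) (auto simp: openin_open)
      qed
    qed (use cont in \<open>auto simp: topspace_ucc_topology\<close>)
    then show ?thesis
      using continuous_map_compose[OF _ quotient_imp_continuous_map[OF quotient_map_mod_const]]
      by (simp add: comp_def)
  qed
  ultimately have "compactin C_star (mod_const ` L)"
    by (intro image_compactin[of "top_of_set L"]) (auto simp: compactin_subtopology)
  moreover have "horo_compactification d \<subseteq> mod_const ` L"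
  proof
    fix \<xi> assume \<xi>: "\<xi> \<in> horo_compactification d"
    then obtain f where f: "continuous_on UNIV f" "\<xi> = mod_const f"
      using compactification_subset_topspace topspace_C_star_cases by blast
    define g where "g = (\<lambda>x. f x - f z)"
    have "f x - f y \<le> d x y" for x y
      using horo_diff_lipschitz[OF \<xi>, of x y] f by (simp add: horo_diff_mod_const)
    then have g: "g \<in> L" by (simp add: L_def g_def)
    have "mod_const g = mod_const f"
      using f cont[OF g] by (subst mod_const_eq_iff) (auto simp: g_def)
    then show "\<xi> \<in> mod_const ` L" using g f by auto
  qed
  ultimately show ?thesis
    by (rule closed_compactin) (simp add: horo_compactification_def)
qed

end

section \<open>The domain of discontinuity of a coarsely quasiconvex orbit\<close>

text \<open>The last assumption has two parts: the orbit is coarsely geodesic, since an orbit point is found at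
  any prescribed distance \<open>r\<close>, and the distance functions are quasiconvex, in the strong sense of
  negative curvature, along these coarse geodesics.\<close>

locale quasiconvex_orbit = topological_metric d + group G
  for d :: "'y::topological_space \<Rightarrow> 'y \<Rightarrow> real" and G (structure) +
  fixes \<phi> :: "'g \<Rightarrow> 'y \<Rightarrow> 'y" and base :: 'y and C :: real
  assumes act_one: "\<phi> \<one> = id"
    and act_mult: "\<And>g h. g \<in> carrier G \<Longrightarrow> h \<in> carrier G \<Longrightarrow> \<phi> (g \<otimes> h) = \<phi> g \<circ> \<phi> h"
    and act_isometry: "\<And>g x y. g \<in> carrier G \<Longrightarrow> d (\<phi> g x) (\<phi> g y) = d x y"
    and finite_orbit_ball: "\<And>R. finite {g \<in> carrier G. d base (\<phi> g base) \<le> R}"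
    and C_nonneg: "0 \<le> C"
    and interpolate: "\<And>g r. g \<in> carrier G \<Longrightarrow> 0 \<le> r \<Longrightarrow> r \<le> d base (\<phi> g base) \<Longrightarrow>
      \<exists>h\<in>carrier G. \<bar>d base (\<phi> h base) - r\<bar> \<le> C \<and>
        (\<forall>y. d y (\<phi> h base) \<le> max (d y base - d base (\<phi> h base))
                                  (d y (\<phi> g base) - d (\<phi> h base) (\<phi> g base)) + C)"
begin

definition height :: "('y \<Rightarrow> real) set \<Rightarrow> 'g \<Rightarrow> real" where
  "height \<xi> g = horo_diff \<xi> (\<phi> g base) base"

definition orbit_proper :: "('y \<Rightarrow> real) set set" where
  "orbit_proper = {\<xi> \<in> horo_compactification d. \<forall>R. finite {g \<in> carrier G. height \<xi> g \<le> R}}"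

lemma act_inverse:
  assumes "g \<in> carrier G"
  shows "\<phi> g \<circ> \<phi> (inv g) = id" "\<phi> (inv g) \<circ> \<phi> g = id"
  using act_mult[of g "inv g"] act_mult[of "inv g" g] assms by (simp_all add: act_one)

lemma act_bij: "g \<in> carrier G \<Longrightarrow> bij (\<phi> g)"
  using act_inverse o_bij by blast

lemma act_inv_into: "g \<in> carrier G \<Longrightarrow> inv_into UNIV (\<phi> g) = \<phi> (inv g)"
  by (metis act_inverse inv_unique_comp)

lemma act_homeo:
  assumes "g \<in> carrier G"
  shows "bij (\<phi> g)" "continuous_on UNIV (\<phi> g)" "continuous_on UNIV (inv_into UNIV (\<phi> g))"
  using assms act_bij act_isometry isometry_continuous by (auto simp: act_inv_into)

lemma act_compactification:
  assumes "g \<in> carrier G" "\<xi> \<in> horo_compactification d"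
  shows "horo_act (\<phi> g) \<xi> \<in> horo_compactification d"
  using horo_act_compactification[OF act_homeo[OF assms(1)] act_isometry[OF assms(1)] assms(2)] .

lemma act_range:
  assumes "g \<in> carrier G" "\<xi> \<in> range (horo_embed d)"
  shows "horo_act (\<phi> g) \<xi> \<in> range (horo_embed d)"
  using assms(2) horo_act_embed[where d = d, OF act_homeo[OF assms(1)] continuous_dist act_isometry[OF assms(1)]]
  by auto

lemma act_inverse_cancel:
  assumes "g \<in> carrier G"
  shows "horo_act (\<phi> g) (horo_act (\<phi> (inv g)) \<xi>) = \<xi>"
    "horo_act (\<phi> (inv g)) (horo_act (\<phi> g) \<xi>) = \<xi>"
  using assms by (simp_all add: act_bij act_inverse horo_act_id flip: horo_act_comp)

lemma height_act:
  assumes "g \<in> carrier G" "h \<in> carrier G" "\<xi> \<in> horo_compactification d"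
  shows "height (horo_act (\<phi> g) \<xi>) h = height \<xi> (inv g \<otimes> h) - height \<xi> (inv g)"
proof -
  have \<xi>: "\<xi> \<in> topspace C_star" using assms compactification_subset_topspace by blast
  have "\<phi> g (\<phi> (inv g) x) = x" for x using act_inverse(1)[OF assms(1)] by (metis comp_apply id_apply)
  then have "height (horo_act (\<phi> g) \<xi>) h
      = horo_diff (horo_act (\<phi> g) \<xi>) (\<phi> g (\<phi> (inv g) (\<phi> h base))) (\<phi> g (\<phi> (inv g) base))"
    by (simp add: height_def)
  also have "\<dots> = horo_diff \<xi> (\<phi> (inv g \<otimes> h) base) (\<phi> (inv g) base)"
    using assms by (simp add: horo_diff_horo_act[OF act_homeo[OF assms(1)] \<xi>] act_mult)
  also have "\<dots> = height \<xi> (inv g \<otimes> h) - height \<xi> (inv g)"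
    using horo_diff_split[OF \<xi>, of "\<phi> (inv g \<otimes> h) base" base "\<phi> (inv g) base"] unfolding height_def by simp
  finally show ?thesis .
qed

lemma height_one: "\<xi> \<in> horo_compactification d \<Longrightarrow> height \<xi> \<one> = 0"
  using horo_diff_split[of \<xi> base base base] compactification_subset_topspace
  by (auto simp: height_def act_one)

lemma orbit_proper_act:
  assumes g: "g \<in> carrier G" and \<xi>: "\<xi> \<in> orbit_proper"
  shows "horo_act (\<phi> g) \<xi> \<in> orbit_proper"
proof -
  have \<xi>': "\<xi> \<in> horo_compactification d" using \<xi> by (simp add: orbit_proper_def)
  have "finite {h \<in> carrier G. height (horo_act (\<phi> g) \<xi>) h \<le> R}" for R
  proof (rule finite_surj)
    show "finite {h \<in> carrier G. height \<xi> h \<le> R + height \<xi> (inv g)}"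
      using \<xi> by (simp add: orbit_proper_def)
    show "{h \<in> carrier G. height (horo_act (\<phi> g) \<xi>) h \<le> R}
        \<subseteq> (\<otimes>) g ` {h \<in> carrier G. height \<xi> h \<le> R + height \<xi> (inv g)}"
    proof
      fix h assume h: "h \<in> {h \<in> carrier G. height (horo_act (\<phi> g) \<xi>) h \<le> R}"
      then have "inv g \<otimes> h \<in> {h \<in> carrier G. height \<xi> h \<le> R + height \<xi> (inv g)}"
        using g by (auto simp: height_act[OF g _ \<xi>'])
      moreover have "h = g \<otimes> (inv g \<otimes> h)" using g h by (simp add: m_assoc[symmetric])
      ultimately show "h \<in> (\<otimes>) g ` {h \<in> carrier G. height \<xi> h \<le> R + height \<xi> (inv g)}" by blast
    qed
  qed
  then show ?thesis using act_compactification[OF g \<xi>'] by (simp add: orbit_proper_def)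
qed

lemma embed_orbit_proper: "range (horo_embed d) \<subseteq> orbit_proper"
proof -
  have "finite {g \<in> carrier G. height (horo_embed d q) g \<le> R}" for q R
  proof (rule finite_subset)
    show "{g \<in> carrier G. height (horo_embed d q) g \<le> R} \<subseteq>
        {g \<in> carrier G. d base (\<phi> g base) \<le> R + 2 * d q base}"
    proof safe
      fix g assume "height (horo_embed d q) g \<le> R"
      then have "d q (\<phi> g base) - d q base \<le> R" by (simp add: height_def horo_diff_embed)
      moreover have "d base (\<phi> g base) \<le> d q base + d q (\<phi> g base)"
        using M.triangle[of base q "\<phi> g base"] M.commute[of base q] by simp
      ultimately show "d base (\<phi> g base) \<le> R + 2 * d q base" by linarith
    qed
  qed (rule finite_orbit_ball)
  then show ?thesis using range_subset_compactification by (auto simp: orbit_proper_def)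
qed

text \<open>The quasiconvexity of distance functions is a closed condition, with an orbit point \<open>h\<close> that does
  not depend on the function, so all horofunctions inherit it with the same constant.\<close>

lemma height_quasiconvex:
  assumes g: "g \<in> carrier G" and r: "0 \<le> r" "r \<le> d base (\<phi> g base)"
  obtains h where "h \<in> carrier G" "\<bar>d base (\<phi> h base) - r\<bar> \<le> C"
    "\<And>\<xi>. \<xi> \<in> horo_compactification d \<Longrightarrow>
      height \<xi> h \<le> max (- d base (\<phi> h base)) (height \<xi> g - d (\<phi> h base) (\<phi> g base)) + C"
proof -
  obtain h where h: "h \<in> carrier G" "\<bar>d base (\<phi> h base) - r\<bar> \<le> C"
    "\<And>y. d y (\<phi> h base) \<le> max (d y base - d base (\<phi> h base))
                                  (d y (\<phi> g base) - d (\<phi> h base) (\<phi> g base)) + C"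
    using interpolate[OF g r] by blast
  let ?F = "\<lambda>\<xi>. height \<xi> h - (max (- d base (\<phi> h base)) (height \<xi> g - d (\<phi> h base) (\<phi> g base)) + C)"
  have "?F \<xi> \<le> 0" if "\<xi> \<in> horo_compactification d" for \<xi>
  proof (rule compactification_closed_condition[of ?F, OF _ _ that])
    show "continuous_map C_star euclideanreal ?F"
      unfolding height_def by (intro continuous_intros continuous_map_horo_diff)
    show "?F (horo_embed d q) \<le> 0" for q
      using h(3)[of q] by (simp add: height_def horo_diff_embed max_def split: if_splits)
  qed
  then show ?thesis using h(1,2) by (intro that[of h]) auto
qed

text \<open>Let \<open>\<xi>\<close> have a proper height function. Every orbit point outside some ball is joined to the base
  point by a coarse geodesic that crosses a sphere (thickened to finite width, so only finitely many
  orbit points lie on it) on which the height of \<open>\<xi>\<close> is large. Nearby classes still have large height at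
  these finitely many points, and quasiconvexity forces the height to keep growing linearly behind
  them. So properness is an open condition, and the points of nonpositive height stay in one finite
  set for all nearby classes.\<close>

lemma orbit_proper_locally_uniform:
  assumes \<xi>: "\<xi> \<in> orbit_proper"
  obtains V B where "openin C_star V" "\<xi> \<in> V" "finite B"
    "V \<inter> horo_compactification d \<subseteq> orbit_proper"
    "\<And>\<zeta> g. \<zeta> \<in> V \<inter> horo_compactification d \<Longrightarrow> g \<in> carrier G - B \<Longrightarrow> height \<zeta> g > 0"
proof -
  \<comment> \<open>A height above \<open>2 C + 1\<close> drops to no less than \<open>2 C\<close> for nearby classes, which is what it takes to exclude
    the decreasing branch of the quasiconvexity estimate. The radius \<open>r\<close> exceeds \<open>R0\<close> by \<open>C + 1\<close> so
    that orbit points within \<open>C\<close> of the sphere lie outside \<open>B0\<close>.\<close>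
  define B0 where "B0 = {g \<in> carrier G. height \<xi> g \<le> 2 * C + 1}"
  have "finite B0" using \<xi> by (simp add: B0_def orbit_proper_def)
  then obtain R0 where R0: "\<And>g. g \<in> B0 \<Longrightarrow> d base (\<phi> g base) \<le> R0" "R0 \<ge> 0"
  proof -
    have "bdd_above ((\<lambda>g. d base (\<phi> g base)) ` B0)" using \<open>finite B0\<close> by simp
    then obtain M where "\<And>g. g \<in> B0 \<Longrightarrow> d base (\<phi> g base) \<le> M" by (auto simp: bdd_above_def)
    then show ?thesis using that[of "max M 0"] by (meson max.coboundedI1 max.cobounded2)
  qed
  define r where "r = R0 + C + 1"
  define B where "B = {g \<in> carrier G. d base (\<phi> g base) \<le> r + C}"
  have B: "finite B" unfolding B_def by (rule finite_orbit_ball)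
  define V where "V = {\<zeta> \<in> topspace C_star. \<forall>g\<in>B. height \<zeta> g > height \<xi> g - 1}"
  have V: "openin C_star V"
  proof -
    have "openin C_star {\<zeta> \<in> topspace C_star. height \<zeta> g \<in> {height \<xi> g - 1<..}}" for g
      unfolding height_def
      by (rule openin_continuous_map_preimage[OF continuous_map_horo_diff]) simp
    then have "openin C_star (topspace C_star \<inter>
        \<Inter> ((\<lambda>g. {\<zeta> \<in> topspace C_star. height \<zeta> g \<in> {height \<xi> g - 1<..}}) ` B))"
      using B by (intro openin_Int_Inter) auto
    moreover have "V = topspace C_star \<inter>
        \<Inter> ((\<lambda>g. {\<zeta> \<in> topspace C_star. height \<zeta> g \<in> {height \<xi> g - 1<..}}) ` B)"
      by (auto simp: V_def)
    ultimately show ?thesis by simp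
  qed
  have far: "height \<zeta> g > 0 \<and> height \<zeta> g > d base (\<phi> g base) - (r + C)"
    if \<zeta>: "\<zeta> \<in> V" "\<zeta> \<in> horo_compactification d" and g: "g \<in> carrier G" "g \<notin> B" for \<zeta> g
  proof -
    have "r \<le> d base (\<phi> g base)" using g C_nonneg by (simp add: B_def)
    moreover have "r \<ge> 0" using R0(2) C_nonneg by (simp add: r_def)
    ultimately obtain h where h: "h \<in> carrier G" "\<bar>d base (\<phi> h base) - r\<bar> \<le> C"
      "height \<zeta> h \<le> max (- d base (\<phi> h base)) (height \<zeta> g - d (\<phi> h base) (\<phi> g base)) + C"
      using height_quasiconvex[OF g(1), of r] \<zeta>(2) by blast
    have "h \<in> B" using h by (simp add: B_def)
    moreover have "h \<notin> B0" using R0(1)[of h] h(2) by (auto simp: r_def)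
    ultimately have "height \<zeta> h > 2 * C" using \<zeta>(1) h(1) by (auto simp: V_def B0_def)
    then have "height \<zeta> g > d (\<phi> h base) (\<phi> g base)"
      using h(3) C_nonneg M.nonneg[of base "\<phi> h base"] by linarith
    moreover have "d base (\<phi> g base) \<le> d base (\<phi> h base) + d (\<phi> h base) (\<phi> g base)"
      by (rule M.triangle) auto
    moreover have "d (\<phi> h base) (\<phi> g base) \<ge> 0" by simp
    ultimately show ?thesis using h(2) by linarith
  qed
  have "V \<inter> horo_compactification d \<subseteq> orbit_proper"
  proof
    fix \<zeta> assume \<zeta>: "\<zeta> \<in> V \<inter> horo_compactification d"
    have "finite {g \<in> carrier G. height \<zeta> g \<le> R}" for R
    proof (rule finite_subset)
      show "{g \<in> carrier G. height \<zeta> g \<le> R} \<subseteq> B \<union> {g \<in> carrier G. d base (\<phi> g base) \<le> R + (r + C)}"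
        using far \<zeta> by force
    qed (use B finite_orbit_ball in auto)
    then show "\<zeta> \<in> orbit_proper" using \<zeta> by (simp add: orbit_proper_def)
  qed
  moreover have "\<xi> \<in> V"
    using \<xi> compactification_subset_topspace by (auto simp: V_def orbit_proper_def)
  ultimately show ?thesis using that[OF V _ B] far by blast
qed

text \<open>A compact set that will turn out to meet every orbit of classes with proper height
  function: such a function attains its minimum, and the group moves a minimum to the identity.\<close>

definition centred :: "('y \<Rightarrow> real) set set" where
  "centred = {\<xi> \<in> horo_compactification d. \<forall>g\<in>carrier G. 0 \<le> height \<xi> g}"

lemma compactin_centred: "compactin C_star centred"
proof (rule closed_compactin[OF compactin_compactification])
  have "closedin C_star {\<xi> \<in> topspace C_star. height \<xi> g \<in> {0..}}" for g
    unfolding height_def by (rule closedin_continuous_map_preimage[OF continuous_map_horo_diff]) simp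
  then have "closedin C_star (\<Inter> (insert (horo_compactification d)
      ((\<lambda>g. {\<xi> \<in> topspace C_star. height \<xi> g \<in> {0..}}) ` carrier G)))"
    by (intro closedin_Inter) (auto simp: horo_compactification_def)
  moreover have "centred = \<Inter> (insert (horo_compactification d)
      ((\<lambda>g. {\<xi> \<in> topspace C_star. height \<xi> g \<in> {0..}}) ` carrier G))"
    using compactification_subset_topspace by (auto simp: centred_def)
  ultimately show "closedin C_star centred" by simp
qed (auto simp: centred_def)

text \<open>A height function with its minimum at the identity cannot be small at a distant orbit point: the
  coarse midpoint would lie strictly lower than both ends, up to a constant, hence below the minimum.
  This makes a closed condition imply properness, with a bound uniform in the class.\<close>

lemma centred_orbit_proper: "centred \<subseteq> orbit_proper"
proof
  fix \<xi> assume \<xi>: "\<xi> \<in> centred"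
  then have \<xi>': "\<xi> \<in> horo_compactification d" by (simp add: centred_def)
  have "finite {g \<in> carrier G. height \<xi> g \<le> R}" for R
  proof (rule finite_subset)
    show "{g \<in> carrier G. height \<xi> g \<le> R} \<subseteq> {g \<in> carrier G. d base (\<phi> g base) \<le> 2 * (\<bar>R\<bar> + 2 * C)}"
    proof (intro subsetI CollectI conjI)
      fix g assume "g \<in> {g \<in> carrier G. height \<xi> g \<le> R}"
      then have g: "g \<in> carrier G" "height \<xi> g \<le> R" by auto
      obtain h where h: "h \<in> carrier G" "\<bar>d base (\<phi> h base) - d base (\<phi> g base) / 2\<bar> \<le> C"
        "height \<xi> h \<le> max (- d base (\<phi> h base)) (height \<xi> g - d (\<phi> h base) (\<phi> g base)) + C"
        using height_quasiconvex[OF g(1), of "d base (\<phi> g base) / 2"] \<xi>' by auto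
      have "0 \<le> height \<xi> h" using \<xi> h(1) by (simp add: centred_def)
      moreover have "d base (\<phi> g base) \<le> d base (\<phi> h base) + d (\<phi> h base) (\<phi> g base)"
        by (rule M.triangle) auto
      moreover have "d base (\<phi> h base) - d base (\<phi> g base) / 2 \<le> C"
        "d base (\<phi> g base) / 2 - d base (\<phi> h base) \<le> C"
        using h(2) by linarith+
      moreover have "height \<xi> h \<le> - d base (\<phi> h base) + C \<or>
          height \<xi> h \<le> height \<xi> g - d (\<phi> h base) (\<phi> g base) + C"
        using h(3) by linarith
      moreover have "R \<le> \<bar>R\<bar>" "0 \<le> \<bar>R\<bar>" by simp_all
      ultimately show "d base (\<phi> g base) \<le> 2 * (\<bar>R\<bar> + 2 * C)"
        using g(2) by argo
    qed auto
  qed (rule finite_orbit_ball)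
  then show "\<xi> \<in> orbit_proper" using \<xi>' by (simp add: orbit_proper_def)
qed

lemma orbit_proper_minimum:
  assumes "\<xi> \<in> orbit_proper"
  obtains g where "g \<in> carrier G" "\<And>h. h \<in> carrier G \<Longrightarrow> height \<xi> g \<le> height \<xi> h"
proof -
  have \<xi>: "\<xi> \<in> horo_compactification d" using assms by (simp add: orbit_proper_def)
  let ?S = "{g \<in> carrier G. height \<xi> g \<le> 0}"
  have S: "finite ?S" "\<one> \<in> ?S" using assms height_one[OF \<xi>] by (auto simp: orbit_proper_def)
  define g where "g = arg_min_on (height \<xi>) ?S"
  have g: "g \<in> ?S" and least: "height \<xi> g \<le> height \<xi> h" if "h \<in> ?S" for h
    unfolding g_def using S arg_min_if_finite(1)[of ?S "height \<xi>"] arg_min_least[of ?S h "height \<xi>"] that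
    by blast+
  show ?thesis
  proof (rule that[of g])
    show "g \<in> carrier G" using g[OF S(2)] by simp
    show "height \<xi> g \<le> height \<xi> h" if "h \<in> carrier G" for h
      using least[of h] g[OF S(2)] that by (cases "height \<xi> h \<le> 0") auto
  qed
qed

theorem orbit_proper_cocompact:
  assumes "\<xi> \<in> orbit_proper"
  shows "\<exists>g\<in>carrier G. \<xi> \<in> horo_act (\<phi> g) ` centred"
proof -
  have \<xi>: "\<xi> \<in> horo_compactification d" using assms by (simp add: orbit_proper_def)
  obtain g where g: "g \<in> carrier G" "\<And>h. h \<in> carrier G \<Longrightarrow> height \<xi> g \<le> height \<xi> h"
    using orbit_proper_minimum[OF assms] by blast
  have "horo_act (\<phi> (inv g)) \<xi> \<in> centred"
    using g act_compactification[OF _ \<xi>, of "inv g"] by (auto simp: centred_def height_act[OF _ _ \<xi>])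
  then have "\<xi> \<in> horo_act (\<phi> g) ` centred"
    using act_inverse_cancel(1)[OF g(1), of \<xi>] by (metis imageI)
  then show ?thesis using g(1) by blast
qed

text \<open>By \<open>orbit_proper_locally_uniform\<close> and compactness, the minima of the height functions of all
  classes in \<open>K\<close> lie in one finite set \<open>S\<close>. An element that moves some class of \<open>K\<close> into \<open>K\<close> carries a
  minimum to a minimum, so it is a quotient of two elements of \<open>S\<close>.\<close>

theorem orbit_proper_properly_discontinuous:
  assumes K: "compactin C_star K" "K \<subseteq> orbit_proper"
  shows "finite {g \<in> carrier G. horo_act (\<phi> g) ` K \<inter> K \<noteq> {}}"
proof -
  have KH: "K \<subseteq> horo_compactification d" using K(2) by (auto simp: orbit_proper_def)
  have "\<exists>V B. openin C_star V \<and> \<xi> \<in> V \<and> finite B \<and>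
      (\<forall>\<zeta>\<in>V \<inter> horo_compactification d. \<forall>g\<in>carrier G - B. height \<zeta> g > 0)" if "\<xi> \<in> K" for \<xi>
  proof -
    have "\<xi> \<in> orbit_proper" using that K(2) by blast
    then obtain V B where "openin C_star V" "\<xi> \<in> V" "finite B"
      "\<And>\<zeta> g. \<zeta> \<in> V \<inter> horo_compactification d \<Longrightarrow> g \<in> carrier G - B \<Longrightarrow> height \<zeta> g > 0"
      by (rule orbit_proper_locally_uniform) blast
    then show ?thesis by (intro exI[of _ V] exI[of _ B]) simp
  qed
  then obtain V B where VB: "\<And>\<xi>. \<xi> \<in> K \<Longrightarrow> openin C_star (V \<xi>) \<and> \<xi> \<in> V \<xi> \<and> finite (B \<xi>) \<and>
      (\<forall>\<zeta>\<in>V \<xi> \<inter> horo_compactification d. \<forall>g\<in>carrier G - B \<xi>. height \<zeta> g > 0)"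
    by metis
  have "\<exists>\<F>. finite \<F> \<and> \<F> \<subseteq> V ` K \<and> K \<subseteq> \<Union>\<F>"
    using VB by (intro compactinD[OF K(1)]) auto
  then obtain \<F> where "finite \<F>" "\<F> \<subseteq> V ` K" "K \<subseteq> \<Union>\<F>" by blast
  then obtain K' where K': "finite K'" "K' \<subseteq> K" "K \<subseteq> (\<Union>\<xi>\<in>K'. V \<xi>)"
    using finite_subset_image[of \<F> V K] by blast
  define S where "S = (\<Union>\<xi>\<in>K'. B \<xi>)"
  have S: "finite S" using K' VB by (auto simp: S_def)
  have pos: "height \<zeta> g > 0" if \<zeta>: "\<zeta> \<in> K" "g \<in> carrier G" "g \<notin> S" for \<zeta> g
  proof -
    obtain \<xi> where "\<xi> \<in> K'" "\<zeta> \<in> V \<xi>" using \<zeta>(1) K'(3) by blast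
    then show ?thesis using VB[of \<xi>] \<zeta> KH K'(2) by (auto simp: S_def)
  qed
  have "{g \<in> carrier G. horo_act (\<phi> g) ` K \<inter> K \<noteq> {}} \<subseteq> (\<lambda>(s, t). s \<otimes> inv t) ` (S \<times> S)"
  proof
    fix g assume "g \<in> {g \<in> carrier G. horo_act (\<phi> g) ` K \<inter> K \<noteq> {}}"
    then obtain \<xi> where g: "g \<in> carrier G" and \<xi>: "\<xi> \<in> K" "horo_act (\<phi> g) \<xi> \<in> K" by blast
    obtain t where t: "t \<in> carrier G" "\<And>h. h \<in> carrier G \<Longrightarrow> height \<xi> t \<le> height \<xi> h"
      using orbit_proper_minimum[of \<xi>] \<xi> K(2) by blast
    have \<xi>H: "\<xi> \<in> horo_compactification d" using \<xi> KH by blast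
    have "height \<xi> t \<le> 0" using t(2)[of \<one>] height_one[OF \<xi>H] by simp
    then have "t \<in> S" using pos[OF \<xi>(1) t(1)] by linarith
    moreover have "height (horo_act (\<phi> g) \<xi>) (g \<otimes> t) \<le> 0"
      using g t by (simp add: height_act[OF g _ \<xi>H] m_assoc[symmetric])
    then have "g \<otimes> t \<in> S" using pos[OF \<xi>(2), of "g \<otimes> t"] g t(1) by (meson m_closed not_le)
    moreover have "g = (g \<otimes> t) \<otimes> inv t" using g t(1) by (simp add: m_assoc)
    ultimately show "g \<in> (\<lambda>(s, t). s \<otimes> inv t) ` (S \<times> S)" by (metis (no_types, lifting) SigmaI case_prod_conv imageI)
  qed
  then show ?thesis using S by (meson finite_SigmaI finite_imageI finite_subset)
qed

theorem horo_domain_of_discontinuity: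
  "\<exists>\<Omega>. openin (subtopology C_star (ideal_boundary d)) \<Omega> \<and>
     (\<forall>g\<in>carrier G. horo_act (\<phi> g) ` \<Omega> = \<Omega>) \<and>
     properly_discontinuous_action G (subtopology C_star (range (horo_embed d) \<union> \<Omega>))
       (\<lambda>g. horo_act (\<phi> g)) \<and>
     cocompact_action G (subtopology C_star (range (horo_embed d) \<union> \<Omega>)) (\<lambda>g. horo_act (\<phi> g))"
proof (intro exI conjI ballI)
  let ?\<Omega> = "orbit_proper - range (horo_embed d)"
  have Z: "range (horo_embed d) \<union> ?\<Omega> = orbit_proper" using embed_orbit_proper by blast
  have PH: "orbit_proper \<subseteq> horo_compactification d" by (auto simp: orbit_proper_def)
  show "openin (subtopology C_star (ideal_boundary d)) ?\<Omega>"
  proof (subst openin_subopen, intro ballI)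
    fix \<xi> assume \<xi>: "\<xi> \<in> ?\<Omega>"
    then obtain V where V: "openin C_star V" "\<xi> \<in> V" "V \<inter> horo_compactification d \<subseteq> orbit_proper"
      by (auto elim: orbit_proper_locally_uniform)
    have "openin (subtopology C_star (ideal_boundary d)) (V \<inter> ideal_boundary d)"
      using V(1) by (auto simp: openin_subtopology)
    then show "\<exists>T. openin (subtopology C_star (ideal_boundary d)) T \<and> \<xi> \<in> T \<and> T \<subseteq> ?\<Omega>"
      using V \<xi> PH by (intro exI[of _ "V \<inter> ideal_boundary d"]) (auto simp: ideal_boundary_def)
  qed
  have sub: "horo_act (\<phi> g) ` ?\<Omega> \<subseteq> ?\<Omega>" if g: "g \<in> carrier G" for g
  proof (intro image_subsetI DiffI notI)
    fix \<xi> assume \<xi>: "\<xi> \<in> ?\<Omega>"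
    then show "horo_act (\<phi> g) \<xi> \<in> orbit_proper" using orbit_proper_act[OF g] by blast
    assume "horo_act (\<phi> g) \<xi> \<in> range (horo_embed d)"
    then have "horo_act (\<phi> (inv g)) (horo_act (\<phi> g) \<xi>) \<in> range (horo_embed d)"
      using act_range[of "inv g"] g by simp
    then show False using \<xi> act_inverse_cancel(2)[OF g] by simp
  qed
  show "horo_act (\<phi> g) ` ?\<Omega> = ?\<Omega>" if g: "g \<in> carrier G" for g
  proof
    show "?\<Omega> \<subseteq> horo_act (\<phi> g) ` ?\<Omega>"
    proof
      fix \<xi> assume "\<xi> \<in> ?\<Omega>"
      then have "horo_act (\<phi> (inv g)) \<xi> \<in> ?\<Omega>" using sub[of "inv g"] g by blast
      then show "\<xi> \<in> horo_act (\<phi> g) ` ?\<Omega>" using act_inverse_cancel(1)[OF g, of \<xi>] by (metis imageI)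
    qed
  qed (rule sub[OF g])
  show "properly_discontinuous_action G (subtopology C_star (range (horo_embed d) \<union> ?\<Omega>))
      (\<lambda>g. horo_act (\<phi> g))"
    unfolding properly_discontinuous_action_def Z
    using orbit_proper_properly_discontinuous by (simp add: compactin_subtopology)
  show "cocompact_action G (subtopology C_star (range (horo_embed d) \<union> ?\<Omega>)) (\<lambda>g. horo_act (\<phi> g))"
    unfolding cocompact_action_def Z
    using orbit_proper_cocompact compactin_centred centred_orbit_proper
    by (intro exI[of _ centred]) (auto simp: compactin_subtopology)
qed

end

section \<open>Discrete and cocompact isometric actions\<close>

lemma hom_Isom_isometry:
  assumes "\<rho> \<in> hom G Isom" "g \<in> carrier G"
  shows "dist (\<rho> g x) (\<rho> g y) = dist x y"
  using assms by (auto simp: hom_def Isom_def)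

lemma hom_Isom_mult:
  assumes "\<rho> \<in> hom G Isom" "g \<in> carrier G" "h \<in> carrier G"
  shows "\<rho> (g \<otimes>\<^bsub>G\<^esub> h) = \<rho> g \<circ> \<rho> h"
  using hom_mult[OF assms] by (simp add: Isom_def)

lemma hom_Isom_one:
  assumes "group G" "\<rho> \<in> hom G Isom"
  shows "\<rho> \<one>\<^bsub>G\<^esub> = id"
  using hom_one[OF assms(2,1) group_Isom] by (simp add: Isom_def)

lemma discrete_rep_isolated_id:
  assumes "group G" "\<rho> \<in> hom G Isom" "discrete_rep G \<rho>"
  obtains K e where "compact K" "e > 0"
    "\<And>g. g \<in> carrier G \<Longrightarrow> (\<And>x. x \<in> K \<Longrightarrow> dist x (\<rho> g x) < e) \<Longrightarrow> \<rho> g = id"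
proof -
  interpret group G by fact
  have "id \<in> \<rho> ` carrier G" using hom_Isom_one[OF assms(1,2)] one_closed by (metis imageI)
  then have "openin (subtopology Isom_topology (\<rho> ` carrier G)) {id}"
    using assms(3) by (simp add: discrete_rep_def)
  then obtain U where U: "openin ucc_topology U" "{id} = U \<inter> carrier Isom \<inter> \<rho> ` carrier G"
    unfolding Isom_topology_def by (auto simp: openin_subtopology subtopology_subtopology)
  then obtain K e where K: "compact K" "e > 0" "ucc_nhd id K e \<subseteq> U"
    unfolding openin_ucc_topology by blast
  have "\<rho> g = id" if g: "g \<in> carrier G" "\<And>x. x \<in> K \<Longrightarrow> dist x (\<rho> g x) < e" for g
  proof -
    have "continuous_on UNIV (\<rho> g)"
      using hom_Isom_isometry[OF assms(2) g(1)] unfolding continuous_on_iff by auto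
    then have "\<rho> g \<in> U" using K(3) g(2) by (auto simp: ucc_nhd_def)
    moreover have "\<rho> g \<in> carrier Isom" using assms(2) g(1) by (auto simp: hom_def)
    ultimately show ?thesis using U(2) g(1) by blast
  qed
  then show ?thesis using that[OF K(1,2)] by blast
qed

text \<open>If infinitely many elements moved \<open>p\<close> by at most \<open>R\<close>, then by pigeonhole infinitely many of them
  would agree up to \<open>e\<close> on the compact set \<open>K\<close> of an isolating neighbourhood of the identity: round the
  images of a finite net of \<open>K\<close> to a finite net of a large ball. Two such elements differ by an element
  of the kernel, which is finite.\<close>

lemma discrete_rep_finite_orbit_ball:
  fixes \<rho> :: "'g \<Rightarrow> 'a::heine_borel \<Rightarrow> 'a" and G :: "('g, 'm) monoid_scheme"
  assumes G: "group G" "\<rho> \<in> hom G Isom" "discrete_rep G \<rho>" and ker: "finite (kernel G Isom \<rho>)"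
  shows "finite {g \<in> carrier G. dist p (\<rho> g p) \<le> R}" (is "finite ?A")
proof (rule ccontr)
  assume inf: "infinite ?A"
  interpret group G by fact
  obtain K e where K: "compact K" "e > 0"
    "\<And>g. g \<in> carrier G \<Longrightarrow> (\<And>x. x \<in> K \<Longrightarrow> dist x (\<rho> g x) < e) \<Longrightarrow> \<rho> g = id"
    using discrete_rep_isolated_id[OF G] by metis
  have net: "\<exists>F. finite F \<and> (\<forall>x\<in>S. \<exists>y\<in>F. dist x y < e / 4)" if S: "compact S" for S :: "'a set"
  proof -
    obtain F where "finite F" "S \<subseteq> (\<Union>y\<in>F. ball y (e / 4))"
      using S K(2) unfolding compact_eq_totally_bounded by (metis divide_pos_pos zero_less_numeral)
    then show ?thesis by (intro exI[of _ F]) (fastforce simp: dist_commute)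
  qed
  obtain F0 where F0: "finite F0" "\<And>x. x \<in> K \<Longrightarrow> \<exists>y\<in>F0. dist x y < e / 4"
    using net[OF K(1)] by blast
  obtain M where M: "\<And>y. y \<in> F0 \<Longrightarrow> dist p y \<le> M"
    using finite_imp_bounded[OF F0(1)] unfolding bounded_any_center[where a = p] by blast
  obtain N where N: "finite N" "\<And>x. x \<in> cball p (R + M) \<Longrightarrow> \<exists>y\<in>N. dist x y < e / 4"
    using net[of "cball p (R + M)"] by auto
  have "\<exists>n\<in>N. dist (\<rho> g y) n < e / 4" if "g \<in> ?A" "y \<in> F0" for g y
  proof (rule N(2))
    have "dist p (\<rho> g y) \<le> dist p (\<rho> g p) + dist (\<rho> g p) (\<rho> g y)" by (rule dist_triangle)
    then show "\<rho> g y \<in> cball p (R + M)"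
      using that M[of y] hom_Isom_isometry[OF G(2), of g p y] by simp
  qed
  then obtain n where n: "\<And>g y. g \<in> ?A \<Longrightarrow> y \<in> F0 \<Longrightarrow> n g y \<in> N \<and> dist (\<rho> g y) (n g y) < e / 4"
    by metis
  let ?code = "\<lambda>g. restrict (n g) F0"
  have "?code ` ?A \<subseteq> F0 \<rightarrow>\<^sub>E N" using n by auto
  then have "finite (?code ` ?A)"
    by (rule finite_subset) (intro finite_PiE F0(1) N(1))
  then obtain g where g: "g \<in> ?A" "infinite {h \<in> ?A. ?code h = ?code g}"
    using pigeonhole_infinite[OF inf, of ?code] by auto
  have "{h \<in> ?A. ?code h = ?code g} \<subseteq> (\<otimes>\<^bsub>G\<^esub>) g ` kernel G Isom \<rho>"
  proof
    fix h assume "h \<in> {h \<in> ?A. ?code h = ?code g}"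
    then have h: "h \<in> ?A" "?code h = ?code g" by auto
    have gh: "g \<in> carrier G" "h \<in> carrier G" "inv\<^bsub>G\<^esub> g \<otimes>\<^bsub>G\<^esub> h \<in> carrier G" using g h by auto
    have "\<rho> (inv\<^bsub>G\<^esub> g \<otimes>\<^bsub>G\<^esub> h) = id"
    proof (rule K(3)[OF gh(3)])
      fix x assume "x \<in> K"
      then obtain y where y: "y \<in> F0" "dist x y < e / 4" using F0(2) by blast
      have eq: "n h y = n g y" using h(2) y(1) by (metis restrict_apply')
      have "\<rho> g (\<rho> (inv\<^bsub>G\<^esub> g \<otimes>\<^bsub>G\<^esub> h) x) = \<rho> h x"
        using hom_Isom_mult[OF G(2) gh(1,3)] gh by (simp add: m_assoc[symmetric])
      then have "dist x (\<rho> (inv\<^bsub>G\<^esub> g \<otimes>\<^bsub>G\<^esub> h) x) = dist (\<rho> g x) (\<rho> h x)"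
        using hom_Isom_isometry[OF G(2) gh(1)] by metis
      also have "\<dots> \<le> dist (\<rho> g x) (\<rho> g y) + dist (\<rho> g y) (n g y) + dist (\<rho> h y) (n g y) + dist (\<rho> h x) (\<rho> h y)"
        using dist_triangle[of "\<rho> g x" "\<rho> h x" "\<rho> g y"] dist_triangle[of "\<rho> g y" "\<rho> h x" "n g y"]
          dist_triangle[of "n g y" "\<rho> h x" "\<rho> h y"] by (simp add: dist_commute)
      also have "\<dots> < e / 4 + e / 4 + e / 4 + e / 4"
        using n[OF g(1) y(1)] n[OF h(1) y(1)] eq y(2) hom_Isom_isometry[OF G(2) gh(1)]
          hom_Isom_isometry[OF G(2) gh(2)] by (intro add_strict_mono) auto
      finally show "dist x (\<rho> (inv\<^bsub>G\<^esub> g \<otimes>\<^bsub>G\<^esub> h) x) < e" by simp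
    qed
    then have "inv\<^bsub>G\<^esub> g \<otimes>\<^bsub>G\<^esub> h \<in> kernel G Isom \<rho>" using gh by (simp add: kernel_def Isom_def)
    moreover have "h = g \<otimes>\<^bsub>G\<^esub> (inv\<^bsub>G\<^esub> g \<otimes>\<^bsub>G\<^esub> h)" using gh by (simp add: m_assoc[symmetric])
    ultimately show "h \<in> (\<otimes>\<^bsub>G\<^esub>) g ` kernel G Isom \<rho>" by blast
  qed
  then show False using g(2) ker finite_surj by blast
qed

lemma cocompact_action_cobounded:
  assumes "\<rho> \<in> hom G Isom" "cocompact_action G euclidean \<rho>"
  obtains D where "\<And>x. \<exists>g\<in>carrier G. dist x (\<rho> g p) \<le> D"
proof -
  obtain K where K: "compact K" "\<And>x. x \<in> (\<Union>g\<in>carrier G. \<rho> g ` K)"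
    using assms(2) unfolding cocompact_action_def compactin_euclidean_iff topspace_euclidean by blast
  obtain D where D: "\<And>x. x \<in> K \<Longrightarrow> dist p x \<le> D"
    using compact_imp_bounded[OF K(1)] unfolding bounded_any_center[where a = p] by blast
  have "\<exists>g\<in>carrier G. dist x (\<rho> g p) \<le> D" for x
  proof -
    obtain g y where g: "g \<in> carrier G" "y \<in> K" "x = \<rho> g y" using K(2)[of x] by blast
    then have "dist x (\<rho> g p) = dist y p" using hom_Isom_isometry[OF assms(1)] by simp
    then show ?thesis using g D[of y] by (intro bexI[of _ g]) (simp_all add: dist_commute)
  qed
  then show ?thesis using that by blast
qed

section \<open>Coarsely equivalent actions on two CAT(-1) spaces\<close>

lemma max_quasiconvex_combine:
  fixes a1 a2 b1 b2 c1 c2 e1 e2 u1 u2 k L :: real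
  assumes u: "u1 \<le> max (a1 - b1) (c1 - e1) + L" "u2 \<le> max (a2 - b2) (c2 - e2) + L"
    and b: "\<bar>b1 - b2\<bar> \<le> k" and e: "\<bar>e1 - e2\<bar> \<le> k"
  shows "max u1 u2 \<le> max (max a1 a2 - max b1 b2) (max c1 c2 - max e1 e2) + (L + k)"
proof -
  define P where "P = max a1 a2 - max b1 b2"
  define Q where "Q = max c1 c2 - max e1 e2"
  have "max b1 b2 \<le> b1 + k" "max b1 b2 \<le> b2 + k" "max e1 e2 \<le> e1 + k" "max e1 e2 \<le> e2 + k"
    using b e by auto
  then have "a1 - b1 \<le> P + k" "a2 - b2 \<le> P + k" "c1 - e1 \<le> Q + k" "c2 - e2 \<le> Q + k"
    unfolding P_def Q_def by (auto simp: le_max_iff_disj)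
  then have "u1 \<le> max P Q + (L + k)" "u2 \<le> max P Q + (L + k)"
    using u by linarith+
  then show ?thesis by (simp add: P_def Q_def)
qed

text \<open>Follow a geodesic of the first factor from \<open>p\<close> to \<open>\<rho>\<^sub>1 g p\<close> and take an orbit point near the point at the prescribed distance. By
  coarse equivalence the corresponding orbit point of the second factor almost realises the triangle
  inequality there, so the quasiconvexity estimate holds in both factors; and as the
  distances in the two factors agree up to \<open>k\<close>, the two estimates combine for the maximum metric. The
  element \<open>e\<close>, later the identity, expresses that the base points lie on the orbits.\<close>

lemma coarsely_equivalent_orbit_interpolation:
  fixes \<rho>\<^sub>1 :: "'g \<Rightarrow> 'a::metric_space \<Rightarrow> 'a" and \<rho>\<^sub>2 :: "'g \<Rightarrow> 'b::metric_space \<Rightarrow> 'b"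
  assumes cat: "CAT_minus1 TYPE('a)" "CAT_minus1 TYPE('b)"
    and coarse: "\<And>g h. g \<in> carrier G \<Longrightarrow> h \<in> carrier G \<Longrightarrow>
      \<bar>dist (\<rho>\<^sub>1 g p) (\<rho>\<^sub>1 h p) - dist (\<rho>\<^sub>2 g q) (\<rho>\<^sub>2 h q)\<bar> \<le> k"
    and cobounded: "\<And>x. \<exists>g\<in>carrier G. dist x (\<rho>\<^sub>1 g p) \<le> D"
    and e: "e \<in> carrier G" and g: "g \<in> carrier G"
    and base: "\<rho>\<^sub>1 e p = p" "\<rho>\<^sub>2 e q = q"
    and r: "0 \<le> r" "r \<le> d_max (p, q) (\<rho>\<^sub>1 g p, \<rho>\<^sub>2 g q)"
  shows "\<exists>h\<in>carrier G. \<bar>d_max (p, q) (\<rho>\<^sub>1 h p, \<rho>\<^sub>2 h q) - r\<bar> \<le> 4 * D + 7 * k + 3 * ln 4 \<and>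
     (\<forall>y. d_max y (\<rho>\<^sub>1 h p, \<rho>\<^sub>2 h q) \<le>
        max (d_max y (p, q) - d_max (p, q) (\<rho>\<^sub>1 h p, \<rho>\<^sub>2 h q))
            (d_max y (\<rho>\<^sub>1 g p, \<rho>\<^sub>2 g q) - d_max (\<rho>\<^sub>1 h p, \<rho>\<^sub>2 h q) (\<rho>\<^sub>1 g p, \<rho>\<^sub>2 g q))
        + (4 * D + 7 * k + 3 * ln 4))"
proof -
  let ?g1 = "\<rho>\<^sub>1 g p" and ?g2 = "\<rho>\<^sub>2 g q"
  have k0: "k \<ge> 0" using coarse[OF e e] by simp
  obtain c where c: "geodesic_path c p ?g1" using CAT_minus1_geodesic[OF cat(1)] .
  \<comment> \<open>The distance \<open>r\<close> is bounded by the larger of the two displacements, which may exceed the length of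
    the geodesic \<open>c\<close> by up to \<open>k\<close>.\<close>
  define t where "t = min r (dist p ?g1)"
  have t: "0 \<le> t" "t \<le> dist p ?g1" using r(1) by (auto simp: t_def)
  have ct: "dist p (c t) = t" "dist (c t) ?g1 = dist p ?g1 - t" using geodesic_path_dist[OF c t] by auto
  obtain h where h: "h \<in> carrier G" "dist (c t) (\<rho>\<^sub>1 h p) \<le> D" using cobounded by blast
  let ?h1 = "\<rho>\<^sub>1 h p" and ?h2 = "\<rho>\<^sub>2 h q"
  have D0: "D \<ge> 0" using h(2) zero_le_dist order_trans by blast
  have eg: "\<bar>dist p ?g1 - dist q ?g2\<bar> \<le> k" and eh: "\<bar>dist p ?h1 - dist q ?h2\<bar> \<le> k"
    and hg: "\<bar>dist ?h1 ?g1 - dist ?h2 ?g2\<bar> \<le> k"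
    using coarse[OF e g] coarse[OF e h(1)] coarse[OF h(1) g] by (simp_all add: base)
  have ln4: "ln (4::real) \<ge> 0" by simp
  have "\<bar>dist p ?h1 - t\<bar> \<le> D"
    using ct h(2) dist_triangle[of p ?h1 "c t"] dist_triangle[of p "c t" ?h1]
    by (simp add: dist_commute abs_le_iff)
  moreover have "\<bar>t - r\<bar> \<le> k" using r(2) eg k0 unfolding d_max_def t_def by simp
  ultimately have near: "\<bar>d_max (p, q) (?h1, ?h2) - r\<bar> \<le> 4 * D + 7 * k + 3 * ln 4"
    using eh D0 k0 ln4 unfolding d_max_def fst_conv snd_conv by linarith
  \<comment> \<open>The defects \<open>2 D\<close> and \<open>2 D + 3 k\<close> enter the quasiconvexity estimate with factor two; replacing the
    distance in one factor by the maximum of both costs another \<open>k\<close>.\<close>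
  have b1: "dist p ?h1 + dist ?h1 ?g1 \<le> dist p ?g1 + 2 * D"
    using ct h(2) dist_triangle[of p ?h1 "c t"] dist_triangle[of ?h1 ?g1 "c t"] by (simp add: dist_commute)
  then have b2: "dist q ?h2 + dist ?h2 ?g2 \<le> dist q ?g2 + (2 * D + 3 * k)"
    using eg eh hg by linarith
  have "d_max y (?h1, ?h2) \<le> max (d_max y (p, q) - d_max (p, q) (?h1, ?h2))
      (d_max y (?g1, ?g2) - d_max (?h1, ?h2) (?g1, ?g2)) + (4 * D + 7 * k + 3 * ln 4)" for y
  proof -
    let ?L = "4 * D + 6 * k + 3 * ln 4"
    have 1: "dist (fst y) ?h1 \<le> max (dist (fst y) p - dist p ?h1) (dist (fst y) ?g1 - dist ?h1 ?g1) + ?L"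
      using CAT_minus1_dist_to_quasi_between[OF cat(1) b1, of "fst y"] k0 by linarith
    have 2: "dist (snd y) ?h2 \<le> max (dist (snd y) q - dist q ?h2) (dist (snd y) ?g2 - dist ?h2 ?g2) + ?L"
      using CAT_minus1_dist_to_quasi_between[OF cat(2) b2, of "snd y"] by simp
    have "?L + k = 4 * D + 7 * k + 3 * ln 4" by simp
    then show ?thesis
      using max_quasiconvex_combine[OF 1 2 eh hg] unfolding d_max_def fst_conv snd_conv by metis
  qed
  then show ?thesis using h(1) near by blast
qed

theorem theorem1p3:
  fixes \<Gamma> :: "('g, 'm) monoid_scheme"
    and \<rho>\<^sub>1 :: "'g \<Rightarrow> 'a::heine_borel \<Rightarrow> 'a"
    and \<rho>\<^sub>2 :: "'g \<Rightarrow> 'b::heine_borel \<Rightarrow> 'b"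
  assumes "CAT_minus1 TYPE('a)" and "CAT_minus1 TYPE('b)"
    and "hyperbolic_group \<Gamma>"
    and "\<rho>\<^sub>1 \<in> hom \<Gamma> Isom" and "\<rho>\<^sub>2 \<in> hom \<Gamma> Isom"
    and "cocompact_action \<Gamma> euclidean \<rho>\<^sub>1" and "cocompact_action \<Gamma> euclidean \<rho>\<^sub>2"
    and "discrete_rep \<Gamma> \<rho>\<^sub>1" and "discrete_rep \<Gamma> \<rho>\<^sub>2"
    and "finite (kernel \<Gamma> Isom \<rho>\<^sub>1)" and "finite (kernel \<Gamma> Isom \<rho>\<^sub>2)"
    and "coarsely_equivalent \<Gamma> \<rho>\<^sub>1 \<rho>\<^sub>2"
  shows "\<exists>\<Omega>. openin (subtopology C_star (ideal_boundary (d_max :: 'a \<times> 'b \<Rightarrow> 'a \<times> 'b \<Rightarrow> real))) \<Omega> \<and>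
     (\<forall>\<gamma>\<in>carrier \<Gamma>. product_action \<rho>\<^sub>1 \<rho>\<^sub>2 \<gamma> ` \<Omega> = \<Omega>) \<and>
     properly_discontinuous_action \<Gamma>
       (subtopology C_star (range (horo_embed d_max) \<union> \<Omega>)) (product_action \<rho>\<^sub>1 \<rho>\<^sub>2) \<and>
     cocompact_action \<Gamma>
       (subtopology C_star (range (horo_embed d_max) \<union> \<Omega>)) (product_action \<rho>\<^sub>1 \<rho>\<^sub>2)"
proof -
  have \<Gamma>: "group \<Gamma>" using assms(3) by (simp add: hyperbolic_group_def)
  interpret group \<Gamma> by (rule \<Gamma>)
  obtain k p q where k: "k > 0" "\<And>g h. g \<in> carrier \<Gamma> \<Longrightarrow> h \<in> carrier \<Gamma> \<Longrightarrow>
      \<bar>dist (\<rho>\<^sub>1 g p) (\<rho>\<^sub>1 h p) - dist (\<rho>\<^sub>2 g q) (\<rho>\<^sub>2 h q)\<bar> \<le> k"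
    using assms(12) unfolding coarsely_equivalent_def by blast
  obtain D where D: "\<And>x. \<exists>g\<in>carrier \<Gamma>. dist x (\<rho>\<^sub>1 g p) \<le> D"
    using cocompact_action_cobounded[OF assms(4,6)] by metis
  have D0: "D \<ge> 0" using D[of p] zero_le_dist order_trans by blast
  have one: "\<rho>\<^sub>1 \<one>\<^bsub>\<Gamma>\<^esub> = id" "\<rho>\<^sub>2 \<one>\<^bsub>\<Gamma>\<^esub> = id" using hom_Isom_one \<Gamma> assms(4,5) by auto
  define \<phi> where "\<phi> = (\<lambda>g. map_prod (\<rho>\<^sub>1 g) (\<rho>\<^sub>2 g))"
  interpret quasiconvex_orbit "d_max :: 'a \<times> 'b \<Rightarrow> 'a \<times> 'b \<Rightarrow> real" \<Gamma> \<phi> "(p, q)" "4 * D + 7 * k + 3 * ln 4"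
  proof (intro quasiconvex_orbit.intro topological_metric.intro quasiconvex_orbit_axioms.intro \<Gamma>)
    show "Metric_space UNIV (d_max :: 'a \<times> 'b \<Rightarrow> 'a \<times> 'b \<Rightarrow> real)" by (rule Metric_space_d_max)
    show "Metric_space.mtopology UNIV (d_max :: 'a \<times> 'b \<Rightarrow> 'a \<times> 'b \<Rightarrow> real) = euclidean"
      by (rule mtopology_d_max)
    show "\<phi> \<one>\<^bsub>\<Gamma>\<^esub> = id" by (simp add: \<phi>_def one fun_eq_iff)
    show "\<phi> (g \<otimes>\<^bsub>\<Gamma>\<^esub> h) = \<phi> g \<circ> \<phi> h" if "g \<in> carrier \<Gamma>" "h \<in> carrier \<Gamma>" for g h
      using that assms(4,5) by (auto simp: \<phi>_def hom_Isom_mult fun_eq_iff)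
    show "d_max (\<phi> g x) (\<phi> g y) = d_max x y" if "g \<in> carrier \<Gamma>" for g x y
      using that assms(4,5) by (cases x; cases y) (simp add: \<phi>_def d_max_def hom_Isom_isometry)
    show "finite {g \<in> carrier \<Gamma>. d_max (p, q) (\<phi> g (p, q)) \<le> R}" for R
      by (rule finite_subset[OF _ discrete_rep_finite_orbit_ball[OF \<Gamma> assms(4,8,10), of p R]])
        (auto simp: \<phi>_def d_max_def)
    show "0 \<le> 4 * D + 7 * k + 3 * ln 4" using D0 k(1) by simp
    show "\<exists>h\<in>carrier \<Gamma>. \<bar>d_max (p, q) (\<phi> h (p, q)) - r\<bar> \<le> 4 * D + 7 * k + 3 * ln 4 \<and>
        (\<forall>y. d_max y (\<phi> h (p, q)) \<le> max (d_max y (p, q) - d_max (p, q) (\<phi> h (p, q)))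
          (d_max y (\<phi> g (p, q)) - d_max (\<phi> h (p, q)) (\<phi> g (p, q))) + (4 * D + 7 * k + 3 * ln 4))"
      if "g \<in> carrier \<Gamma>" "0 \<le> r" "r \<le> d_max (p, q) (\<phi> g (p, q))" for g r
      using coarsely_equivalent_orbit_interpolation[where \<rho>\<^sub>1 = \<rho>\<^sub>1 and \<rho>\<^sub>2 = \<rho>\<^sub>2 and p = p and q = q,
          OF assms(1,2) k(2) D one_closed that(1), of r] that(2,3)
      by (simp add: \<phi>_def one)
  qed
  have "product_action \<rho>\<^sub>1 \<rho>\<^sub>2 = (\<lambda>g. horo_act (\<phi> g))"
    by (simp add: fun_eq_iff product_action_def \<phi>_def)
  then show ?thesis using horo_domain_of_discontinuity by simp
qed

end
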